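(* The closure in $L^\infty(\mathbb D)$ of $B_0(\mathcal L(A^2))=\{B_0(S):S\in\mathcal L(A^2)\}$ equals $\mathcal A$, the algebra of bounded functions $a:\mathbb D\to\mathbb C$ that are uniformly continuous from $(\mathbb D,\beta)$ to $(\mathbb C,|\cdot|)$, where $\beta$ is the hyperbolic metric on $\mathbb D$.
   Context: $\mathbb D$ open unit disc, $dA$ normalized area measure, $A^2$ Bergman space with $\langle f,g\rangle=\int f\bar g\,dA$, $\mathcal L(A^2)$ its bounded operators. $\varphi_z(w)=(z-w)/(1-\bar zw)$, $U_zf=(f\circ\varphi_z)\varphi_z'$, $e_0\equiv1$. The Berezin transform of $Q\in\mathcal L(A^2)$ is $B_0(Q)(z)=\langle QU_ze_0,U_ze_0\rangle$. *)

theory Defs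
  imports "HOL-Analysis.Analysis"
begin

abbreviation disc :: "complex set" where
  "disc \<equiv> ball 0 1"

text \<open>Elements of the Bergman space are represented canonically as functions
  complex \<Rightarrow> complex that vanish outside the disc.\<close>
definition bergman_space :: "(complex \<Rightarrow> complex) set" where
  "bergman_space = {f. f holomorphic_on disc \<and> (\<forall>w. w \<notin> disc \<longrightarrow> f w = 0)
      \<and> integrable lborel (\<lambda>w. (cmod (f w))\<^sup>2)}"

text \<open>Inner product with respect to normalized area measure dA = dx dy / pi.\<close>
definition berg_inner :: "(complex \<Rightarrow> complex) \<Rightarrow> (complex \<Rightarrow> complex) \<Rightarrow> complex" where
  "berg_inner f g = (LINT w:disc|lborel. f w * cnj (g w)) / of_real pi"

definition berg_norm :: "(complex \<Rightarrow> complex) \<Rightarrow> real" where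
  "berg_norm f = sqrt (Re (berg_inner f f))"

definition bounded_op :: "((complex \<Rightarrow> complex) \<Rightarrow> (complex \<Rightarrow> complex)) \<Rightarrow> bool" where
  "bounded_op Q \<longleftrightarrow>
     (\<forall>f\<in>bergman_space. Q f \<in> bergman_space) \<and>
     (\<forall>f\<in>bergman_space. \<forall>g\<in>bergman_space. \<forall>a b :: complex.
        Q (\<lambda>w. a * f w + b * g w) = (\<lambda>w. a * Q f w + b * Q g w)) \<and>
     (\<exists>C. \<forall>f\<in>bergman_space. berg_norm (Q f) \<le> C * berg_norm f)"

definition phi :: "complex \<Rightarrow> complex \<Rightarrow> complex" where
  "phi z w = (z - w) / (1 - cnj z * w)"

definition U_op :: "complex \<Rightarrow> (complex \<Rightarrow> complex) \<Rightarrow> (complex \<Rightarrow> complex)" where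
  "U_op z f = (\<lambda>w. if w \<in> disc then f (phi z w) * deriv (phi z) w else 0)"

definition e0 :: "complex \<Rightarrow> complex" where
  "e0 = (\<lambda>w. if w \<in> disc then 1 else 0)"

definition berezin :: "((complex \<Rightarrow> complex) \<Rightarrow> (complex \<Rightarrow> complex)) \<Rightarrow> complex \<Rightarrow> complex" where
  "berezin Q z = berg_inner (Q (U_op z e0)) (U_op z e0)"

definition berezin_range :: "(complex \<Rightarrow> complex) set" where
  "berezin_range = {berezin Q | Q. bounded_op Q}"

definition Linf_closure :: "(complex \<Rightarrow> complex) set \<Rightarrow> (complex \<Rightarrow> complex) set" where
  "Linf_closure S = {a. \<forall>e>0. \<exists>s\<in>S.
      AE z in lebesgue. z \<in> disc \<longrightarrow> cmod (a z - s z) < e}"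

definition hyp_dist :: "complex \<Rightarrow> complex \<Rightarrow> real" where
  "hyp_dist z w = ln ((1 + cmod (phi z w)) / (1 - cmod (phi z w))) / 2"

definition calA :: "(complex \<Rightarrow> complex) set" where
  "calA = {a. (\<exists>M. \<forall>z\<in>disc. cmod (a z) \<le> M) \<and>
     (\<forall>e>0. \<exists>d>0. \<forall>z\<in>disc. \<forall>w\<in>disc. hyp_dist z w < d \<longrightarrow> cmod (a z - a w) < e)}"

end

(*
  Berezin transforms are Lipschitz for the pseudohyperbolic distance: after multiplication by a
  unimodular constant c the normalized kernels satisfy ||k_z - c k_w||^2 = 2 |phi_z(w)|^2. Hence
  they lie in the algebra A, which is closed under uniform limits.

  Conversely, for a in A the averages of a against the densities (n+1)(1 - |phi_z|^2)^n |k_z|^2 dA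
  converge to a uniformly. Each average is exactly the Berezin transform of a bounded operator,
  namely the integral of a(zeta) U_zeta R_n U_zeta^* with respect to the invariant measure
  dA(zeta) / (1 - |zeta|^2)^2, where R_n is the finite rank operator with integral kernel
  (n+1)(1 - x conj(u))^n. The integrand has an explicit kernel, dominated by
  (n+1) 2^n / (|1 - conj(zeta) x|^2 |1 - conj(u) zeta|^2), so boundedness reduces to the Schur test
  for the positive Bergman operator. No change of variables is needed: rotation invariance of area
  and power series give the weighted reproducing formula, and with it the normalization of the
  densities.
*)
theory Submission
  imports Defs "HOL-Complex_Analysis.Complex_Analysis" "HOL-Probability.Distribution_Functions"
begin

section \<open>Normalized area measure\<close>

text \<open>For n = 0 the operator R_0 projects onto the constants and its average is the Toeplitz
  operator with symbol a. Its Berezin transform averages a against |k_z|^2, whose hyperbolic spread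
  is fixed, so it cannot approximate a. The factor (1 - |phi_z|^2)^n concentrates the mass near z,
  at a rate in hyperbolic distance that is the same for all z. A kernel holomorphic in x and
  antiholomorphic in u is determined by its diagonal; polarizing (n+1)(1 - |x|^2)^n gives the kernel
  of R_n. The obstacle is boundedness: the invariant measure has infinite mass, so a uniform bound
  on the conjugates of R_n does not bound their integral. All estimates are made on absolute values,
  using |1 - phi(x) conj(phi(u))| <= 2, hence the factor 2^n. Its growth is harmless, since n is
  fixed once the accuracy is chosen, and the same absolute bounds justify every exchange of
  integrals. The Schur test uses the weight 1/sqrt(1 - |u|^2), and its integral is explicit because
  |1 - v|^(-2) is a Poisson kernel divided by 1 - |v|^2.\<close>

definition complex_of_vec :: "real^2 \<Rightarrow> complex" where
  "complex_of_vec v = Complex (v $ 1) (v $ 2)"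

definition vec_of_complex :: "complex \<Rightarrow> real^2" where
  "vec_of_complex z = vector [Re z, Im z]"

lemma complex_vec_inverse [simp]:
  "complex_of_vec (vec_of_complex z) = z" "vec_of_complex (complex_of_vec v) = v"
  by (auto simp: complex_of_vec_def vec_of_complex_def complex_eq_iff vec_eq_iff forall_2)

lemma linear_vec_of_complex: "linear vec_of_complex" and linear_complex_of_vec: "linear complex_of_vec"
  by (auto intro!: linearI simp: complex_of_vec_def vec_of_complex_def complex_eq_iff vec_eq_iff forall_2)

lemma norm_vec_of_complex [simp]: "norm (vec_of_complex z) = norm z"
  by (simp add: vec_of_complex_def norm_vec_def L2_set_def sum_2 cmod_def)

lemma norm_complex_of_vec [simp]: "norm (complex_of_vec v) = norm v"
  by (metis complex_vec_inverse(2) norm_vec_of_complex)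

lemma measurable_complex_of_vec [measurable]: "complex_of_vec \<in> borel_measurable borel"
  by (intro borel_measurable_continuous_onI linear_continuous_on linear_conv_bounded_linear[THEN iffD1]
      linear_complex_of_vec)

lemma vimage_complex_of_vec_box:
  "complex_of_vec -` box l u = box (vec_of_complex l) (vec_of_complex u)"
  by (auto simp: box_def Basis_complex_def inner_complex_def complex_of_vec_def vec_of_complex_def
      Basis_vec_def inner_axis forall_2)

text \<open>Invariance of Lebesgue measure under orthogonal maps is used on \<open>real^2\<close>;
  this identity carries it to \<open>complex\<close>. A Borel measure with the right values on boxes
  is \<open>lborel\<close>.\<close>

lemma lborel_complex_of_vec: "(lborel :: complex measure) = distr lborel borel complex_of_vec"
proof (rule lborel_eqI)
  fix l u :: complex
  assume ord: "\<And>b. b \<in> Basis \<Longrightarrow> l \<bullet> b \<le> u \<bullet> b"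
  have le: "Re l \<le> Re u" "Im l \<le> Im u"
    using ord[of 1] ord[of \<i>] by (simp_all add: Basis_complex_def inner_complex_def)
  have B: "(Basis :: (real^2) set) = {axis 1 1, axis 2 1}"
    by (auto simp: Basis_vec_def) (metis exhaust_2)
  have ne: "axis (1::2) (1::real) \<noteq> axis 2 1"
    by (simp add: axis_eq_axis)
  have "emeasure (distr lborel borel complex_of_vec) (box l u)
      = emeasure lborel (box (vec_of_complex l) (vec_of_complex u))"
    by (subst emeasure_distr) (auto simp: vimage_complex_of_vec_box)
  also have "\<dots> = (\<Prod>b\<in>Basis. (u - l) \<bullet> b)"
    using le by (subst emeasure_lborel_box)
       (auto simp: B ne inner_axis vec_of_complex_def Basis_complex_def inner_complex_def)
  finally show "emeasure (distr lborel borel complex_of_vec) (box l u) = (\<Prod>b\<in>Basis. (u - l) \<bullet> b)" .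
qed auto

text \<open>Again only boxes need to be measured. The preimage of a box under multiplication by c is
  its image under multiplication by \<open>cnj c\<close>, an orthogonal map, so its volume is
  unchanged.\<close>

lemma lborel_rotate:
  fixes c :: complex
  assumes "cmod c = 1"
  shows "lborel = distr lborel borel (\<lambda>z. c * z)"
proof (rule lborel_eqI)
  fix l u :: complex
  assume le: "\<And>b. b \<in> Basis \<Longrightarrow> l \<bullet> b \<le> u \<bullet> b"
  let ?r = "\<lambda>v. vec_of_complex (cnj c * complex_of_vec v)"
  let ?B = "box (vec_of_complex l) (vec_of_complex u)"
  have c: "c * cnj c = 1"
    using assms by (simp add: complex_norm_square[symmetric])
  have "linear ?r"
    by (rule linearI) (simp_all add: linear_add[OF linear_complex_of_vec] linear_add[OF linear_vec_of_complex]
       linear_cmul[OF linear_complex_of_vec] linear_cmul[OF linear_vec_of_complex] ring_distribs)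
  then have orth: "orthogonal_transformation ?r"
    using assms by (simp add: orthogonal_transformation norm_mult)
  have vim: "complex_of_vec -` ((\<lambda>z. c * z) -` box l u) = ?r ` ?B"
  proof (intro set_eqI iffI)
    fix v assume "v \<in> complex_of_vec -` ((\<lambda>z. c * z) -` box l u)"
    then have "vec_of_complex (c * complex_of_vec v) \<in> ?B"
      by (simp add: vimage_complex_of_vec_box[symmetric])
    moreover have "v = ?r (vec_of_complex (c * complex_of_vec v))"
      using c by (simp add: mult.assoc[symmetric] mult.commute[of "cnj c" c])
    ultimately show "v \<in> ?r ` ?B" by blast
  next
    fix v assume "v \<in> ?r ` ?B"
    then show "v \<in> complex_of_vec -` ((\<lambda>z. c * z) -` box l u)"
      using c by (auto simp: vimage_complex_of_vec_box[symmetric] mult.assoc[symmetric])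
  qed
  have mB: "?B \<in> lmeasurable" by simp
  have cm[measurable]: "(\<lambda>z. c * z) \<in> borel_measurable borel" by simp
  have S: "complex_of_vec -` ((\<lambda>z. c * z) -` box l u) \<in> sets borel"
    using measurable_sets[OF measurable_comp[OF measurable_complex_of_vec cm], of "box l u"]
    by (simp add: vimage_comp)
  have "emeasure (distr lborel borel (\<lambda>z. c * z)) (box l u)
      = emeasure lborel (complex_of_vec -` ((\<lambda>z. c * z) -` box l u))"
    apply (subst lborel_complex_of_vec)
    apply (subst distr_distr)
    by (auto simp: emeasure_distr vimage_comp)
  also have "\<dots> = emeasure lebesgue (?r ` ?B)"
    using S unfolding vim by (simp add: emeasure_completion)
  also have "\<dots> = emeasure lebesgue ?B"
    using measure_orthogonal_image[OF orth mB] measurable_orthogonal_image[OF orth mB] mB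
    by (simp add: emeasure_eq_measure2)
  also have "\<dots> = emeasure (distr lborel borel complex_of_vec) (box l u)"
    by (subst emeasure_distr) (auto simp: vimage_complex_of_vec_box)
  also have "\<dots> = (\<Prod>b\<in>Basis. (u - l) \<bullet> b)"
    unfolding lborel_complex_of_vec[symmetric] using le by (simp add: emeasure_lborel_box)
  finally show "emeasure (distr lborel borel (\<lambda>z. c * z)) (box l u) = (\<Prod>b\<in>Basis. (u - l) \<bullet> b)" .
qed auto

text \<open>Taken as a density on the whole plane rather than a restricted space: measurability
  stays plain Borel measurability, and membership in the disc is recovered almost everywhere by
  \<open>AE_area\<close>.\<close>

definition area :: "complex measure" where
  "area = density lborel (\<lambda>w. ennreal (indicator disc w / pi))"

lemma sets_area [simp, measurable_cong]: "sets area = sets borel"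
  and space_area [simp]: "space area = UNIV"
  by (auto simp: area_def)

lemma measurable_area_density [measurable]:
  "(\<lambda>w::complex. indicator disc w / pi :: real) \<in> borel_measurable borel"
  by (intro borel_measurable_divide borel_measurable_indicator) auto

lemma AE_areaI:
  assumes "AE w in lborel. w \<in> disc \<longrightarrow> P w"
  shows "AE w in area. P w"
  unfolding area_def using assms by (subst AE_density) (auto simp: indicator_def)

lemma integral_area:
  fixes f :: "complex \<Rightarrow> 'b :: {banach, second_countable_topology}"
  shows "f \<in> borel_measurable borel \<Longrightarrow>
    (\<integral>w. f w \<partial>area) = (\<integral>w. (indicator disc w / pi) *\<^sub>R f w \<partial>lborel)"
  by (simp add: area_def integral_density)

lemma integrable_area:
  fixes f :: "complex \<Rightarrow> 'b :: {banach, second_countable_topology}"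
  shows "f \<in> borel_measurable borel \<Longrightarrow>
    integrable area f \<longleftrightarrow> integrable lborel (\<lambda>w. (indicator disc w / pi) *\<^sub>R f w)"
  by (simp add: area_def integrable_density)

lemma AE_area: "AE w in area. w \<in> disc"
  by (rule AE_areaI) simp

lemma emeasure_disc_radius:
  assumes "0 \<le> r" "r \<le> 1"
  shows "emeasure area (ball 0 r) = ennreal (r\<^sup>2)"
proof -
  have "emeasure area (ball 0 r) = (\<integral>\<^sup>+(w::complex). ennreal (1 / pi) * indicator (ball 0 r) w \<partial>lborel)"
  proof -
    have "ennreal (indicator disc w / pi) * indicator (ball 0 r) w = ennreal (1 / pi) * indicator (ball 0 r) w"
      for w :: complex
      using assms by (cases "w \<in> ball 0 r") auto
    then show ?thesis
      unfolding area_def by (subst emeasure_density) auto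
  qed
  also have "\<dots> = ennreal (1/pi) * ennreal (pi * r\<^sup>2)"
  proof -
    have "emeasure lborel (ball (0::complex) r) = ennreal (pi * r\<^sup>2)"
      using assms by (simp add: emeasure_ball unit_ball_vol_2)
    then show ?thesis by (subst nn_integral_cmult_indicator) auto
  qed
  also have "\<dots> = ennreal (r\<^sup>2)"
    by (simp add: ennreal_mult''[symmetric] assms)
  finally show ?thesis .
qed

lemma emeasure_area_UNIV [simp]: "emeasure area UNIV = 1"
proof -
  have "emeasure area UNIV = emeasure area disc"
    using AE_area by (intro emeasure_eq_AE) auto
  then show ?thesis using emeasure_disc_radius[of 1] by simp
qed

interpretation area: prob_space area
  by (rule prob_spaceI) simp

lemma area_rotate:
  fixes c :: complex
  assumes "cmod c = 1"
  shows "distr area borel (\<lambda>z. c * z) = area"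
proof -
  have "area = density (distr lborel borel (\<lambda>z. c * z)) (\<lambda>w. ennreal (indicator disc w / pi))"
    unfolding area_def lborel_rotate[OF assms, symmetric] ..
  also have "\<dots> = distr (density lborel (\<lambda>w. ennreal (indicator disc (c * w) / pi))) borel (\<lambda>z. c * z)"
    by (rule density_distr) measurable
  also have "(\<lambda>w. ennreal (indicator disc (c * w) / pi)) = (\<lambda>w. ennreal (indicator disc w / pi))"
    using assms by (auto simp: fun_eq_iff indicator_def norm_mult)
  finally show ?thesis by (simp add: area_def)
qed

text \<open>Under normalized area |z|^2 is uniform on [0,1], because the disc of radius r has
  measure r^2. This replaces polar coordinates. Distribution functions are compared, the boundary
  circle being a null set.\<close>

lemma distr_area_norm_sq:
  "distr area borel (\<lambda>z. (cmod z)\<^sup>2) = density lborel (indicator {0..1})"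
proof (rule cdf_unique')
  show fm: "finite_borel_measure (distr area borel (\<lambda>z. (cmod z)\<^sup>2))"
    by (simp add: finite_borel_measure_def finite_borel_measure_axioms_def area.finite_measure_distr)
  show "finite_borel_measure (density lborel (indicator {0..1::real}))"
    by (auto simp: finite_borel_measure_def finite_borel_measure_axioms_def emeasure_density intro!: finite_measureI)
  show "cdf (distr area borel (\<lambda>z. (cmod z)\<^sup>2)) = cdf (density lborel (indicator {0..1::real}))"
  proof (rule ext)
    fix x :: real
    have "emeasure area {z. (cmod z)\<^sup>2 \<le> x} = emeasure lborel {0..min x 1}"
    proof (cases "x < 0")
      case True
      then have "{z. (cmod z)\<^sup>2 \<le> x} = {}" by (auto simp: not_le intro: less_le_trans)
      then show ?thesis using True by simp
    next
      case False
      define r where "r = sqrt (min x 1)"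
      have r: "0 \<le> r" "r \<le> 1" using False by (auto simp: r_def)
      have r2: "r\<^sup>2 = min x 1" using False by (auto simp: r_def)
      have sphere: "AE z in area. cmod z \<noteq> r"
      proof -
        have "sphere (0::complex) r \<in> null_sets lborel"
          using negligible_sphere[of "0::complex" r]
          by (metis borel_closed closed_sphere negligible_iff_null_sets null_sets_completion_iff sets_lborel)
        then have "AE z in lborel. z \<notin> sphere (0::complex) r"
          by (rule AE_not_in)
        then show ?thesis
          by (intro AE_areaI) auto
      qed
      have "emeasure area {z. (cmod z)\<^sup>2 \<le> x} = emeasure area (ball 0 r)"
      proof (rule emeasure_eq_AE)
        show "AE z in area. (z \<in> {z. (cmod z)\<^sup>2 \<le> x}) = (z \<in> ball 0 r)"
          using sphere AE_area
        proof eventually_elim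
          case (elim z)
          then have "(cmod z)\<^sup>2 < 1" by (simp add: power_less_one_iff abs_square_less_1)
          then have "(cmod z)\<^sup>2 \<le> x \<longleftrightarrow> (cmod z)\<^sup>2 \<le> r\<^sup>2" by (auto simp: r2)
          also have "\<dots> \<longleftrightarrow> cmod z < r" using elim r power_mono_iff[of "cmod z" r 2] by (auto simp: le_less)
          finally show ?case by simp
        qed
      qed auto
      then show ?thesis using emeasure_disc_radius[OF r] r2 False by simp
    qed
    moreover have "emeasure (density lborel (indicator {0..1::real})) {..x} = emeasure lborel {0..min x 1}"
      by (subst emeasure_density) (auto simp: nn_integral_indicator[symmetric] simp del: nn_integral_indicator
            intro!: nn_integral_cong split: split_indicator)
    ultimately show "cdf (distr area borel (\<lambda>z. (cmod z)\<^sup>2)) x = cdf (density lborel (indicator {0..1::real})) x"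
      by (simp add: cdf_def measure_def emeasure_distr vimage_def)
  qed
qed

lemma nn_integral_area_radial:
  assumes [measurable]: "g \<in> borel_measurable borel"
  shows "(\<integral>\<^sup>+z. g ((cmod z)\<^sup>2) \<partial>area) = (\<integral>\<^sup>+t. g t * indicator {0..1} t \<partial>lborel)"
proof -
  have "(\<integral>\<^sup>+z. g ((cmod z)\<^sup>2) \<partial>area) = (\<integral>\<^sup>+t. g t \<partial>distr area borel (\<lambda>z. (cmod z)\<^sup>2))"
    by (simp add: nn_integral_distr)
  then show ?thesis
    by (simp add: distr_area_norm_sq nn_integral_density mult.commute)
qed

lemma integral_area_rotate:
  fixes f :: "complex \<Rightarrow> 'b :: {banach, second_countable_topology}"
  assumes [measurable]: "f \<in> borel_measurable borel" and c: "cmod c = 1"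
  shows "(\<integral>z. f (c * z) \<partial>area) = (\<integral>z. f z \<partial>area)"
proof -
  have "(\<integral>z. f z \<partial>area) = (\<integral>z. f z \<partial>distr area borel (\<lambda>z. c * z))"
    by (simp add: area_rotate[OF c])
  then show ?thesis by (simp add: integral_distr)
qed

section \<open>Orthogonality of monomials and the weighted reproducing formula\<close>

lemma measurable_cnj [measurable]: "cnj \<in> borel_measurable borel"
  by (intro borel_measurable_continuous_onI continuous_intros)

lemma norm_mult_cnj_less_1: "w \<in> disc \<Longrightarrow> u \<in> disc \<Longrightarrow> cmod (cnj w * u) < 1"
  using mult_strict_mono'[of "cmod w" 1 "cmod u" 1] by (simp add: norm_mult)

lemma norm_le_integrable_area:
  fixes f :: "complex \<Rightarrow> 'b :: {banach, second_countable_topology}"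
  assumes "f \<in> borel_measurable borel" "\<And>z. z \<in> disc \<Longrightarrow> norm (f z) \<le> B"
  shows "integrable area f"
proof (rule area.integrable_const_bound)
  show "AE z in area. norm (f z) \<le> B"
    using AE_area by eventually_elim (use assms in auto)
qed (use assms in auto)

text \<open>If j and k differ, rotate by a c for which \<open>c ^ j * cnj c ^ k\<close> is -1: the
  integral is then equal to its own negative.\<close>

lemma radial_orthogonality:
  fixes g :: "complex \<Rightarrow> real"
  assumes [measurable]: "g \<in> borel_measurable borel"
    and rot: "\<And>c z. cmod c = 1 \<Longrightarrow> g (c * z) = g z"
  shows "(\<integral>z. of_real (g z) * z ^ j * cnj z ^ k \<partial>area) =
    (if j = k then of_real (\<integral>z. g z * (cmod z) ^ (2 * k) \<partial>area) else 0)"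
proof (cases "j = k")
  case True
  have "of_real (g z) * z ^ k * cnj z ^ k = complex_of_real (g z * (cmod z) ^ (2 * k))" for z
    by (simp add: mult.assoc power_mult_distrib[symmetric] complex_norm_square[symmetric] power_mult)
  with True show ?thesis by (simp only: integral_complex_of_real) simp
next
  case False
  let ?I = "\<integral>z. of_real (g z) * z ^ j * cnj z ^ k \<partial>area"
  define m where "m = (if j > k then j - k else k - j)"
  \<comment> \<open>An m-th root of -1, where m is the difference of the two exponents.\<close>
  define c where "c = cis (pi / real m)"
  have m: "m > 0" using False by (auto simp: m_def)
  have c1: "cmod c = 1" by (simp add: c_def)
  have cm: "c ^ m = -1"
    using m by (simp add: c_def Complex.DeMoivre)
  have cc: "c * cnj c = 1" using c1 by (simp add: complex_norm_square[symmetric])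
  have "c ^ j * cnj c ^ k = -1"
  proof (cases "j > k")
    case True
    then have "c ^ j * cnj c ^ k = c ^ m * (c * cnj c) ^ k"
      by (simp add: m_def power_mult_distrib mult.assoc[symmetric] power_add[symmetric])
    then show ?thesis by (simp add: cc cm)
  next
    case F: False
    then have "c ^ j * cnj c ^ k = cnj (c ^ m) * (c * cnj c) ^ j"
      using False by (simp add: m_def power_mult_distrib mult.left_commute power_add[symmetric])
    then show ?thesis by (simp add: cc cm)
  qed
  then have "of_real (g (c * z)) * (c * z) ^ j * cnj (c * z) ^ k = - (of_real (g z) * z ^ j * cnj z ^ k)" for z
    using rot[OF c1, of z] by (simp add: power_mult_distrib)
      (metis (no_types, opaque_lifting) mult.assoc mult.commute mult_minus_left mult_1)
  moreover have "(\<integral>z. of_real (g (c * z)) * (c * z) ^ j * cnj (c * z) ^ k \<partial>area) = ?I"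
    by (rule integral_area_rotate) (use c1 in auto)
  ultimately have "?I = - ?I" by simp
  then show ?thesis using False by simp
qed

text \<open>On the disc the k-th term is dominated by |h k| |g|, so absolute summability of the
  coefficients permits termwise integration; orthogonality leaves only k = j.\<close>

lemma integral_power_series_cnj_power:
  fixes g :: "complex \<Rightarrow> real"
  assumes g: "integrable area g"
    and rot: "\<And>c z. cmod c = 1 \<Longrightarrow> g (c * z) = g z"
    and h: "summable (\<lambda>k. cmod (h k))"
  shows "integrable area (\<lambda>z. of_real (g z) * (\<Sum>k. h k * z ^ k) * cnj z ^ j)"
    "(\<integral>z. of_real (g z) * (\<Sum>k. h k * z ^ k) * cnj z ^ j \<partial>area)
      = h j * of_real (\<integral>z. g z * (cmod z) ^ (2 * j) \<partial>area)"
proof -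
  have [measurable]: "g \<in> borel_measurable borel"
    using g by (auto dest: borel_measurable_integrable)
  let ?f = "\<lambda>k z. of_real (g z) * (h k * z ^ k) * cnj z ^ j"
  have le: "AE z in area. norm (?f k z) \<le> norm (cmod (h k) * g z)" for k
    using AE_area
  proof eventually_elim
    case (elim z)
    then have "cmod z ^ k * cmod z ^ j \<le> 1"
      by (simp add: power_add[symmetric] power_le_one)
    then have "\<bar>g z\<bar> * cmod (h k) * (cmod z ^ k * cmod z ^ j) \<le> \<bar>g z\<bar> * cmod (h k) * 1"
      by (intro mult_left_mono) auto
    then show ?case by (simp add: norm_mult norm_power abs_mult mult_ac)
  qed
  have int: "integrable area (?f k)" for k
    by (rule Bochner_Integration.integrable_bound[OF _ _ le]) (use g in simp, measurable)
  have sn: "AE z in area. summable (\<lambda>k. norm (?f k z))"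
  proof -
    have "AE z in area. \<forall>k. norm (?f k z) \<le> norm (cmod (h k) * g z)"
      using le by (simp add: AE_all_countable)
    then show ?thesis
    proof eventually_elim
      case (elim z)
      show ?case
        by (rule summable_comparison_test'[OF summable_mult2[OF h, of "\<bar>g z\<bar>"]])
           (use elim in \<open>auto simp: abs_mult\<close>)
    qed
  qed
  have sI: "summable (\<lambda>k. \<integral>z. norm (?f k z) \<partial>area)"
  proof (rule summable_comparison_test'[OF summable_mult2[OF h, of "\<integral>z. \<bar>g z\<bar> \<partial>area"]])
    fix k
    have "(\<integral>z. norm (?f k z) \<partial>area) \<le> (\<integral>z. norm (cmod (h k) * g z) \<partial>area)"
      using le[of k] int[of k] g by (intro integral_mono_AE) auto
    then show "norm (\<integral>z. norm (?f k z) \<partial>area) \<le> cmod (h k) * (\<integral>z. \<bar>g z\<bar> \<partial>area)"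
      by (simp add: abs_mult)
  qed
  have "(\<Sum>k. ?f k z) = of_real (g z) * (\<Sum>k. h k * z ^ k) * cnj z ^ j" if "z \<in> disc" for z
  proof -
    have "summable (\<lambda>k. h k * z ^ k)"
    proof (rule summable_comparison_test'[OF h])
      show "norm (h k * z ^ k) \<le> cmod (h k)" for k
        using that mult_left_mono[of "cmod z ^ k" 1 "cmod (h k)"] by (simp add: norm_mult norm_power power_le_one)
    qed
    then show ?thesis
      by (simp add: suminf_mult suminf_mult2[symmetric] summable_mult)
  qed
  then have eq: "AE z in area. (\<Sum>k. ?f k z) = of_real (g z) * (\<Sum>k. h k * z ^ k) * cnj z ^ j"
    using AE_area by auto
  show "integrable area (\<lambda>z. of_real (g z) * (\<Sum>k. h k * z ^ k) * cnj z ^ j)"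
    using integrable_suminf[OF int sn sI] by (subst integrable_cong_AE[OF _ _ eq, symmetric]) auto
  have "(\<integral>z. ?f k z \<partial>area) = (if k = j then h j * of_real (\<integral>z. g z * (cmod z) ^ (2 * j) \<partial>area) else 0)" for k
  proof -
    have "(\<integral>z. ?f k z \<partial>area) = (\<integral>z. h k * (of_real (g z) * z ^ k * cnj z ^ j) \<partial>area)"
      by (simp add: mult_ac)
    also have "\<dots> = h k * (\<integral>z. of_real (g z) * z ^ k * cnj z ^ j \<partial>area)"
      by (rule integral_mult_right_zero)
    finally show ?thesis
      using rot by (subst (asm) radial_orthogonality) auto
  qed
  then have "(\<lambda>k. if k = j then h j * of_real (\<integral>z. g z * (cmod z) ^ (2 * j) \<partial>area) else 0) sums
     (\<integral>z. (\<Sum>k. ?f k z) \<partial>area)"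
    using sums_integral[OF int sn sI] by simp
  moreover have "(\<lambda>k. if k = j then h j * of_real (\<integral>z. g z * (cmod z) ^ (2 * j) \<partial>area) else 0) sums
      (h j * of_real (\<integral>z. g z * (cmod z) ^ (2 * j) \<partial>area))"
    using sums_single[of j "\<lambda>_. h j * of_real (\<integral>z. g z * (cmod z) ^ (2 * j) \<partial>area)"] by (simp add: eq_commute)
  ultimately have "(\<integral>z. (\<Sum>k. ?f k z) \<partial>area) = h j * of_real (\<integral>z. g z * (cmod z) ^ (2 * j) \<partial>area)"
    using sums_unique2 by blast
  then show "(\<integral>z. of_real (g z) * (\<Sum>k. h k * z ^ k) * cnj z ^ j \<partial>area)
      = h j * of_real (\<integral>z. g z * (cmod z) ^ (2 * j) \<partial>area)"
    using integral_cong_AE[OF _ _ eq] by simp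
qed

text \<open>The second series is expanded in the same way, with the first one kept whole as an
  integrable factor.\<close>

lemma integral_power_series_pairing:
  fixes g :: "complex \<Rightarrow> real"
  assumes g: "integrable area g"
    and rot: "\<And>c z. cmod c = 1 \<Longrightarrow> g (c * z) = g z"
    and h: "summable (\<lambda>k. cmod (h k))" and e: "summable (\<lambda>k. cmod (e k))"
  shows "(\<lambda>j. h j * cnj (e j) * of_real (\<integral>z. g z * (cmod z) ^ (2 * j) \<partial>area)) sums
    (\<integral>z. of_real (g z) * (\<Sum>k. h k * z ^ k) * cnj (\<Sum>j. e j * z ^ j) \<partial>area)"
proof -
  have [measurable]: "g \<in> borel_measurable borel"
    using g by (auto dest: borel_measurable_integrable)
  let ?H = "\<lambda>z. of_real (g z) * (\<Sum>k. h k * z ^ k)"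
  let ?f = "\<lambda>j z. cnj (e j) * (?H z * cnj z ^ j)"
  have H: "integrable area ?H"
    using integral_power_series_cnj_power(1)[OF g rot h, of 0] by simp
  have int: "integrable area (?f j)" for j
    using integral_power_series_cnj_power(1)[OF g rot h, of j] by (rule integrable_mult_right)
  have le: "AE z in area. norm (?f j z) \<le> cmod (e j) * norm (?H z)" for j
    using AE_area
  proof eventually_elim
    case (elim z)
    then have "cmod z ^ j \<le> 1" by (simp add: power_le_one)
    then have "cmod (e j) * norm (?H z) * cmod z ^ j \<le> cmod (e j) * norm (?H z) * 1"
      by (intro mult_left_mono) auto
    then show ?case by (simp add: norm_mult norm_power mult_ac)
  qed
  have sn: "AE z in area. summable (\<lambda>j. norm (?f j z))"
  proof -
    have "AE z in area. \<forall>j. norm (?f j z) \<le> cmod (e j) * norm (?H z)"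
      using le by (simp add: AE_all_countable)
    then show ?thesis
    proof eventually_elim
      case (elim z)
      show ?case
        by (rule summable_comparison_test'[OF summable_mult2[OF e, of "norm (?H z)"]])
           (use elim in auto)
    qed
  qed
  have sI: "summable (\<lambda>j. \<integral>z. norm (?f j z) \<partial>area)"
  proof (rule summable_comparison_test'[OF summable_mult2[OF e, of "\<integral>z. norm (?H z) \<partial>area"]])
    fix j
    have "(\<integral>z. norm (?f j z) \<partial>area) \<le> (\<integral>z. cmod (e j) * norm (?H z) \<partial>area)"
      by (rule integral_mono_AE[OF integrable_norm[OF int] integrable_mult_right[OF integrable_norm[OF H]] le])
    then show "norm (\<integral>z. norm (?f j z) \<partial>area) \<le> cmod (e j) * (\<integral>z. norm (?H z) \<partial>area)"
      by simp
  qed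
  have "(\<Sum>j. ?f j z) = ?H z * cnj (\<Sum>j. e j * z ^ j)" if "z \<in> disc" for z
  proof -
    have "summable (\<lambda>k. e k * z ^ k)"
    proof (rule summable_comparison_test'[OF e])
      show "norm (e k * z ^ k) \<le> cmod (e k)" for k
        using that mult_left_mono[of "cmod z ^ k" 1 "cmod (e k)"] by (simp add: norm_mult norm_power power_le_one)
    qed
    then have "(\<lambda>k. cnj (e k * z ^ k)) sums cnj (\<Sum>j. e j * z ^ j)"
      by (simp only: sums_cnj summable_sums)
    then have "(\<lambda>k. ?H z * cnj (e k * z ^ k)) sums (?H z * cnj (\<Sum>j. e j * z ^ j))"
      by (rule sums_mult)
    then show ?thesis
      by (simp add: sums_iff mult_ac)
  qed
  then have eq: "AE z in area. (\<Sum>j. ?f j z) = ?H z * cnj (\<Sum>j. e j * z ^ j)"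
    using AE_area by auto
  have "(\<lambda>j. \<integral>z. ?f j z \<partial>area) sums (\<integral>z. (\<Sum>j. ?f j z) \<partial>area)"
    by (rule sums_integral[OF int sn sI])
  also have "(\<integral>z. (\<Sum>j. ?f j z) \<partial>area) = (\<integral>z. ?H z * cnj (\<Sum>j. e j * z ^ j) \<partial>area)"
    by (rule integral_cong_AE[OF _ _ eq]) auto
  also have "(\<lambda>j. \<integral>z. ?f j z \<partial>area) = (\<lambda>j. h j * cnj (e j) * of_real (\<integral>z. g z * (cmod z) ^ (2 * j) \<partial>area))"
    using integral_power_series_cnj_power(2)[OF g rot h] by (simp add: fun_eq_iff)
  finally show ?thesis .
qed

text \<open>The integral is pushed forward to the uniform law of |z|^2. The open interval admits
  profiles that are singular at an endpoint, and nonnegativity turns a gauge integral into a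
  Lebesgue integral.\<close>

lemma integral_area_radial:
  fixes g :: "real \<Rightarrow> real"
  assumes [measurable]: "g \<in> borel_measurable borel"
    and nn: "\<And>t. 0 < t \<Longrightarrow> t < 1 \<Longrightarrow> 0 \<le> g t" and I: "(g has_integral r) {0<..<1}"
  shows "(\<integral>z. g ((cmod z)\<^sup>2) \<partial>area) = r" and "integrable area (\<lambda>z. g ((cmod z)\<^sup>2))"
proof -
  \<comment> \<open>The sign of g is known only for 0 < t < 1, so the centre, where t = 0, has to be
    discarded.\<close>
  have z0: "AE z in area. z \<noteq> 0"
    by (rule AE_areaI) (use AE_lborel_singleton[of "0::complex"] in auto)
  have nnae: "AE z in area. 0 \<le> g ((cmod z)\<^sup>2)"
    using AE_area z0 by eventually_elim (auto intro!: nn simp: power_less_one_iff)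
  have r: "0 \<le> r" using has_integral_nonneg[OF I] nn by auto
  have "(\<integral>\<^sup>+z. ennreal (g ((cmod z)\<^sup>2)) \<partial>area) = (\<integral>\<^sup>+t. ennreal (g t) * indicator {0..1} t \<partial>lborel)"
    by (rule nn_integral_area_radial) measurable
  also have "\<dots> = (\<integral>\<^sup>+t. ennreal (g t) * indicator {0<..<1} t \<partial>lborel)"
  proof (rule nn_integral_cong_AE)
    show "AE t in lborel. ennreal (g t) * indicator {0..1} t = ennreal (g t) * indicator {0<..<1} t"
      using AE_lborel_singleton[of "0::real"] AE_lborel_singleton[of "1::real"]
      by eventually_elim (auto split: split_indicator)
  qed
  also have "\<dots> = ennreal r"
    using nn_integral_has_integral_lebesgue'[OF nn I] by auto
  finally have *: "(\<integral>\<^sup>+z. ennreal (g ((cmod z)\<^sup>2)) \<partial>area) = ennreal r" .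
  have "integrable area (\<lambda>z. g ((cmod z)\<^sup>2)) \<and> (\<integral>z. g ((cmod z)\<^sup>2) \<partial>area) = r"
    using * nnae r by (subst nn_integral_eq_integrable[symmetric]) auto
  then show "(\<integral>z. g ((cmod z)\<^sup>2) \<partial>area) = r" "integrable area (\<lambda>z. g ((cmod z)\<^sup>2))" by auto
qed

section \<open>Moments of the weights (1 - |z|^2)^n and their reproducing kernels\<close>

lemma integral_area_Beta:
  "(\<integral>z. (1 - (cmod z)\<^sup>2) ^ n * (cmod z) ^ (2 * k) \<partial>area) = fact k * fact n / fact (k + n + 1)"
proof -
  have "((\<lambda>t. t powr (real (k + 1) - 1) * (1 - t) powr (real (n + 1) - 1)) has_integral
      Beta (real (k + 1)) (real (n + 1))) {0<..<1}"
    using has_integral_Beta_real[of "real (k + 1)" "real (n + 1)"] by (simp add: has_integral_Icc_iff_Ioo)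
  also have "?this \<longleftrightarrow> ((\<lambda>t. (1 - t) ^ n * t ^ k) has_integral Beta (real (k + 1)) (real (n + 1))) {0<..<1}"
    by (rule has_integral_cong) (auto simp: powr_realpow)
  also have "Beta (real (k + 1)) (real (n + 1)) = fact k * fact n / fact (k + n + 1)"
    using Gamma_fact[of k, where 'a = real] Gamma_fact[of n, where 'a = real] Gamma_fact[of "k + n + 1", where 'a = real]
    by (simp add: Beta_def add_ac)
  finally have "((\<lambda>t. (1 - t) ^ n * t ^ k) has_integral (fact k * fact n / fact (k + n + 1) :: real)) {0<..<1}" .
  from integral_area_radial(1)[OF _ _ this] show ?thesis
    by (simp add: power_mult)
qed

text \<open>The generalized binomial series with exponent -(n+2); the sign (-1)^j of its
  coefficients cancels against the power of -z.\<close>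

lemma negative_binomial_series:
  fixes z :: complex
  assumes "cmod z < 1"
  shows "(\<lambda>j. of_nat ((j + n + 1) choose j) * z ^ j) sums (1 / (1 - z) ^ (n + 2))"
proof -
  have nz: "1 - z \<noteq> 0" using assms by auto
  have "(\<lambda>j. ((- of_nat (n + 2)) gchoose j) * (- z) ^ j) sums (1 + - z) powr (- of_nat (n + 2))"
    by (rule gen_binomial_complex) (use assms in simp)
  moreover have "((- of_nat (n + 2)) gchoose j) * (- z) ^ j = of_nat ((j + n + 1) choose j) * z ^ j" for j
  proof -
    have "((- of_nat (n + 2)) gchoose j) = (-1) ^ j * (of_nat ((j + n + 1) choose j) :: complex)"
      by (subst gbinomial_minus) (simp add: binomial_gbinomial add_ac)
    then show ?thesis by (simp add: power_minus[of z])
  qed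
  moreover have "(1 + - z) powr (- of_nat (n + 2)) = 1 / (1 - z) ^ (n + 2)"
    using nz powr_nat'[of "1 - z" "n + 2"] by (simp only: powr_minus) (simp add: inverse_eq_divide)
  ultimately show ?thesis by simp
qed

lemma summable_negative_binomial:
  assumes "0 \<le> r" "r < 1"
  shows "summable (\<lambda>j. real ((j + n + 1) choose j) * r ^ j)"
proof -
  \<comment> \<open>Convergence at the larger radius (1 + r)/2 < 1 gives absolute convergence at
    r.\<close>
  have "summable (\<lambda>j. of_nat ((j + n + 1) choose j) * complex_of_real ((1 + r) / 2) ^ j)"
    by (rule sums_summable[OF negative_binomial_series]) (use assms in \<open>simp only: norm_of_real, simp\<close>)
  then have "summable (\<lambda>j. norm (of_nat ((j + n + 1) choose j) * complex_of_real r ^ j))"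
    by (rule powser_insidea) (use assms in \<open>simp only: norm_of_real, simp\<close>)
  then show ?thesis using assms by (simp add: norm_mult norm_power)
qed

text \<open>The j-th coefficient of the kernel times the j-th moment of the weight is the constant
  1/(n+1), so the pairing returns the Taylor series of h divided by n+1. Holomorphy beyond the
  closed disc makes the Taylor coefficients of h absolutely summable.\<close>

lemma weighted_reproducing:
  assumes h: "h holomorphic_on ball 0 R" "1 < R" and [measurable]: "h \<in> borel_measurable borel" and w: "w \<in> disc"
  shows "(\<integral>u. of_real ((1 - (cmod u)\<^sup>2) ^ n) * h u * cnj (1 / (1 - cnj w * u) ^ (n + 2)) \<partial>area)
    = h w / of_nat (n + 1)"
proof -
  define a where "a = (\<lambda>k. (deriv ^^ k) h 0 / fact k)"
  define e where "e = (\<lambda>j. of_nat ((j + n + 1) choose j) * cnj w ^ j)"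
  have hs: "(\<lambda>k. a k * z ^ k) sums h z" if "z \<in> ball 0 R" for z
    using holomorphic_power_series[OF h(1) that] by (simp add: a_def)
  \<comment> \<open>Convergence of the Taylor series at a radius r > 1 gives absolute convergence at
    1.\<close>
  obtain r where r: "1 < r" "r < R" using h(2) dense by blast
  have "summable (\<lambda>k. norm (a k * 1 ^ k))"
    by (rule powser_insidea[OF sums_summable[OF hs[of "of_real r"]]]) (use r in auto)
  then have sa: "summable (\<lambda>k. cmod (a k))" by simp
  have se: "summable (\<lambda>k. cmod (e k))"
    using summable_negative_binomial[of "cmod w" n] w by (simp add: e_def norm_mult norm_power)
  have es: "(\<lambda>j. e j * u ^ j) sums (1 / (1 - cnj w * u) ^ (n + 2))" if "u \<in> disc" for u
  proof -
    have "cmod (cnj w * u) < 1"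
      using w that by (rule norm_mult_cnj_less_1)
    from negative_binomial_series[OF this, of n] show ?thesis
      by (simp add: e_def power_mult_distrib mult_ac)
  qed
  let ?g = "\<lambda>u. (1 - (cmod u)\<^sup>2) ^ n"
  have g: "integrable area ?g"
  proof (rule norm_le_integrable_area[where B = 1])
    fix z :: complex assume "z \<in> disc"
    then have "(cmod z)\<^sup>2 \<le> 1" by (simp add: power_le_one)
    then show "norm ((1 - (cmod z)\<^sup>2) ^ n) \<le> 1" by (simp add: power_le_one)
  qed simp
  have "(\<lambda>j. a j * cnj (e j) * of_real (\<integral>z. ?g z * (cmod z) ^ (2 * j) \<partial>area)) sums
    (\<integral>z. of_real (?g z) * (\<Sum>k. a k * z ^ k) * cnj (\<Sum>j. e j * z ^ j) \<partial>area)"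
    by (rule integral_power_series_pairing[OF g _ sa se]) (simp add: norm_mult)
  also have "(\<integral>z. of_real (?g z) * (\<Sum>k. a k * z ^ k) * cnj (\<Sum>j. e j * z ^ j) \<partial>area) =
     (\<integral>u. of_real (?g u) * (\<Sum>k. a k * u ^ k) * cnj (1 / (1 - cnj w * u) ^ (n + 2)) \<partial>area)"
  proof (rule integral_cong_AE)
    show "AE z in area. of_real (?g z) * (\<Sum>k. a k * z ^ k) * cnj (\<Sum>j. e j * z ^ j) =
       of_real (?g z) * (\<Sum>k. a k * z ^ k) * cnj (1 / (1 - cnj w * z) ^ (n + 2))"
      using AE_area by eventually_elim (use es in \<open>simp add: sums_iff\<close>)
  qed measurable
  also have "\<dots> = (\<integral>u. of_real (?g u) * h u * cnj (1 / (1 - cnj w * u) ^ (n + 2)) \<partial>area)"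
  proof (rule integral_cong_AE)
    show "AE z in area. of_real (?g z) * (\<Sum>k. a k * z ^ k) * cnj (1 / (1 - cnj w * z) ^ (n + 2)) =
       of_real (?g z) * h z * cnj (1 / (1 - cnj w * z) ^ (n + 2))"
      using AE_area by eventually_elim (use hs h(2) in \<open>simp add: sums_iff\<close>)
  qed measurable
  also have "(\<lambda>j. a j * cnj (e j) * of_real (\<integral>z. ?g z * (cmod z) ^ (2 * j) \<partial>area)) =
     (\<lambda>j. a j * w ^ j / of_nat (n + 1))"
  proof
    fix j
    have "real ((j + n + 1) choose j) * (fact j * fact n / fact (j + n + 1)) = 1 / real (n + 1)"
    proof -
      have "real ((j + n + 1) choose j) = fact (j + n + 1) / (fact j * fact (n + 1))"
        using binomial_fact[of j "j + n + 1", where 'a = real] by simp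
      then have "real ((j + n + 1) choose j) * (fact j * fact n / fact (j + n + 1)) = fact n / fact (n + 1)"
        by (simp del: fact_Suc)
      then show ?thesis by simp
    qed
    then have B: "complex_of_real (real ((j + n + 1) choose j) * (fact j * fact n / fact (j + n + 1))) = 1 / of_nat (n + 1)"
      by (simp only:) simp
    have "a j * cnj (e j) * of_real (\<integral>z. ?g z * (cmod z) ^ (2 * j) \<partial>area)
        = a j * w ^ j * complex_of_real (real ((j + n + 1) choose j) * (fact j * fact n / fact (j + n + 1)))"
      unfolding integral_area_Beta e_def by simp
    then show "a j * cnj (e j) * of_real (\<integral>z. ?g z * (cmod z) ^ (2 * j) \<partial>area) = a j * w ^ j / of_nat (n + 1)"
      unfolding B by simp
  qed
  finally have "(\<lambda>j. a j * w ^ j / of_nat (n + 1)) sums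
    (\<integral>u. of_real (?g u) * h u * cnj (1 / (1 - cnj w * u) ^ (n + 2)) \<partial>area)" .
  moreover have "(\<lambda>j. a j * w ^ j / of_nat (n + 1)) sums (h w / of_nat (n + 1))"
    using hs[of w] w h(2) by (intro sums_divide) auto
  ultimately show ?thesis using sums_unique2 by blast
qed

section \<open>Schur test for the positive Bergman operator\<close>

interpretation area_pair: pair_sigma_finite area area ..

text \<open>The absolute value of the Bergman kernel (1 - x conj(u))^(-2).\<close>

definition kern :: "complex \<Rightarrow> complex \<Rightarrow> real" where
  "kern x u = 1 / (cmod (1 - cnj u * x))\<^sup>2"

lemma kern_nonneg [simp]: "0 \<le> kern x u"
  by (simp add: kern_def)

lemma kern_commute: "kern x u = kern u x"
proof -
  have "cmod (1 - cnj u * x) = cmod (cnj (1 - cnj u * x))" by (simp only: complex_mod_cnj)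
  then show ?thesis by (simp add: kern_def mult.commute)
qed

lemma measurable_kern [measurable (raw)]:
  assumes [measurable]: "f \<in> borel_measurable M" "g \<in> borel_measurable M"
  shows "(\<lambda>p. kern (f p) (g p)) \<in> borel_measurable M"
  unfolding kern_def by measurable

text \<open>An explicit arctangent is the primitive. Its inner square root is not differentiable at
  t = 1, hence the fundamental theorem with differentiability only in the interior.\<close>

lemma has_integral_schur_bound:
  fixes d :: real
  assumes d: "d > 0"
  shows "((\<lambda>t. 2 / (sqrt (1 - t) * (d + (1 - t)))) has_integral 4 / sqrt d * arctan (1 / sqrt d)) {0<..<1}"
proof -
  let ?F = "\<lambda>t. - (4 / sqrt d * arctan (sqrt ((1 - t) / d)))"
  have "((\<lambda>t. 2 / (sqrt (1 - t) * (d + (1 - t)))) has_integral (?F 1 - ?F 0)) {0..1}"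
  proof (rule fundamental_theorem_of_calculus_interior)
    show "continuous_on {0..1} ?F"
      using d by (intro continuous_intros) auto
    fix t :: real assume t: "t \<in> {0<..<1}"
    define q where "q = sqrt ((1 - t) / d)"
    have q: "q > 0" "q\<^sup>2 = (1 - t) / d" using t d by (auto simp: q_def)
    have qs: "q = sqrt (1 - t) / sqrt d" by (simp add: q_def real_sqrt_divide)
    have sd: "sqrt d * sqrt d = d" "sqrt d > 0" using d by auto
    have "(?F has_real_derivative - (4 / sqrt d * (inverse (1 + q\<^sup>2) * (inverse q / 2 * (- 1 / d))))) (at t)"
    proof (intro DERIV_minus DERIV_cmult)
      have "((\<lambda>t. (1 - t) / d) has_real_derivative (- 1 / d)) (at t)"
        using d by (auto intro!: derivative_eq_intros)
      then have "((\<lambda>t. sqrt ((1 - t) / d)) has_real_derivative (inverse q / 2 * (- 1 / d))) (at t)"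
        unfolding q_def by (rule DERIV_chain2[OF DERIV_real_sqrt, rotated]) (use t d in auto)
      then show "((\<lambda>t. arctan (sqrt ((1 - t) / d))) has_real_derivative
          inverse (1 + q\<^sup>2) * (inverse q / 2 * (- 1 / d))) (at t)"
        unfolding q_def by (rule DERIV_chain2[OF DERIV_arctan])
    qed
    also have "- (4 / sqrt d * (inverse (1 + q\<^sup>2) * (inverse q / 2 * (- 1 / d)))) = 2 / (sqrt (1 - t) * (d + (1 - t)))"
    proof -
      have "1 + q\<^sup>2 = (d + (1 - t)) / d" using d by (simp add: q add_divide_distrib)
      then have "inverse (1 + q\<^sup>2) = d / (d + (1 - t))" by simp
      moreover have "inverse q = sqrt d / sqrt (1 - t)" by (simp add: qs)
      moreover have "- (4 / a * (d / e * (a / b / 2 * (- 1 / d)))) = 2 / (b * e)" if "a > 0" for a b e :: real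
        using that d by simp
      ultimately show ?thesis using sd(2) by simp
    qed
    finally show "(?F has_vector_derivative 2 / (sqrt (1 - t) * (d + (1 - t)))) (at t)"
      by (simp add: has_real_derivative_iff_has_vector_derivative)
  qed simp
  then show ?thesis by (simp add: has_integral_Icc_iff_Ioo real_sqrt_divide)
qed

text \<open>With v = conj(x) u, the real part of (1 + v)/(1 - v) is (1 - |v|^2)/|1 - v|^2. The
  kernel thus becomes a radial factor in u times the real part of a power series in u, which radial
  integration can evaluate.\<close>

lemma kern_poisson:
  assumes "x \<in> disc" "u \<in> disc"
  shows "kern x u = Re ((1 + cnj x * u) / (1 - cnj x * u)) / (1 - (cmod x)\<^sup>2 * (cmod u)\<^sup>2)"
proof -
  define v where "v = cnj x * u"
  have v: "cmod v < 1" unfolding v_def by (rule norm_mult_cnj_less_1[OF assms])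
  then have nz: "1 - v \<noteq> 0" by auto
  have "(1 + v) / (1 - v) = (1 + v) * cnj (1 - v) / of_real ((cmod (1 - v))\<^sup>2)"
    by (subst complex_div_cnj) simp
  then have "Re ((1 + v) / (1 - v)) = Re ((1 + v) * cnj (1 - v)) / (cmod (1 - v))\<^sup>2"
    by (simp only: Re_divide_of_real)
  also have "Re ((1 + v) * cnj (1 - v)) = 1 - (cmod v)\<^sup>2"
    unfolding cmod_power2 by (simp add: power2_eq_square algebra_simps)
  finally have "Re ((1 + v) / (1 - v)) / (1 - (cmod v)\<^sup>2) = 1 / (cmod (1 - v))\<^sup>2"
    using v power_less_one_iff[of "cmod v" 2] by simp
  moreover have "kern x u = 1 / (cmod (1 - v))\<^sup>2"
    by (subst kern_commute) (simp add: kern_def v_def)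
  ultimately show ?thesis by (simp add: v_def norm_mult power_mult_distrib)
qed

text \<open>After the Poisson factorization all angular dependence sits in a series with constant
  term 1, so the integral equals that of the radial factor \<open>G\<close>. An arctangent profile
  dominates \<open>G\<close>, and arctan < pi/2 yields the constant 2 pi.\<close>

lemma kern_schur:
  assumes x: "x \<in> disc"
  shows "(\<integral>\<^sup>+u. ennreal (kern x u * (1 / sqrt (1 - (cmod u)\<^sup>2))) \<partial>area)
    \<le> ennreal (2 * pi * (1 / sqrt (1 - (cmod x)\<^sup>2)))"
proof -
  define r where "r = (cmod x)\<^sup>2"
  define d where "d = 1 - r"
  have r: "0 \<le> r" "r < 1" using x by (auto simp: r_def power_less_one_iff)
  then have d: "0 < d" by (simp add: d_def)
  define b where "b = (\<lambda>t. 2 / (sqrt (1 - t) * (d + (1 - t))))"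
  define G where "G = (\<lambda>u::complex. 1 / sqrt (1 - (cmod u)\<^sup>2) / (1 - r * (cmod u)\<^sup>2))"
  have [measurable]: "b \<in> borel_measurable borel" "G \<in> borel_measurable borel"
    unfolding b_def G_def by measurable
  have bnn: "0 < t \<Longrightarrow> t < 1 \<Longrightarrow> 0 \<le> b t" for t using d by (simp add: b_def)
  note I = has_integral_schur_bound[OF d, folded b_def]
  have ib: "integrable area (\<lambda>z. b ((cmod z)\<^sup>2))"
    and Ib: "(\<integral>z. b ((cmod z)\<^sup>2) \<partial>area) = 4 / sqrt d * arctan (1 / sqrt d)"
    by (rule integral_area_radial[OF _ bnn I]; measurable)+
  have Gb: "0 \<le> G u" "G u \<le> b ((cmod u)\<^sup>2)" if "u \<in> disc" for u
  proof -
    define t where "t = (cmod u)\<^sup>2"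
    have t: "0 \<le> t" "t < 1" using that by (auto simp: t_def power_less_one_iff)
    have "r * t \<le> r" "r * t \<le> t" using t r by (auto simp: mult_left_le mult_left_le_one_le)
    \<comment> \<open>Averages the bounds r t <= r and r t <= t. This replaces the product by a sum,
      for which a primitive is known.\<close>
    then have le: "(d + (1 - t)) / 2 \<le> 1 - r * t" by (simp add: d_def)
    have pos: "0 < (d + (1 - t)) / 2" using d t by simp
    have s: "0 < sqrt (1 - t)" using t by simp
    show "0 \<le> G u" using le pos s by (simp add: G_def t_def[symmetric])
    have "G u = 1 / sqrt (1 - t) * (1 / (1 - r * t))" by (simp add: G_def t_def)
    also have "\<dots> \<le> 1 / sqrt (1 - t) * (1 / ((d + (1 - t)) / 2))"
      using le pos s by (intro mult_left_mono divide_left_mono) auto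
    also have "\<dots> = b t" by (simp add: b_def)
    finally show "G u \<le> b ((cmod u)\<^sup>2)" by (simp add: t_def)
  qed
  have iG: "integrable area G"
  proof (rule Bochner_Integration.integrable_bound[OF ib])
    show "AE z in area. norm (G z) \<le> norm (b ((cmod z)\<^sup>2))"
      using AE_area by eventually_elim (use Gb in force)
  qed measurable
  have "(\<integral>u. G u \<partial>area) \<le> 4 / sqrt d * arctan (1 / sqrt d)"
    unfolding Ib[symmetric] using AE_area Gb(2) by (intro integral_mono_AE iG ib) (auto elim: eventually_mono)
  also have "\<dots> \<le> 4 / sqrt d * (pi / 2)"
    using arctan_ubound[of "1 / sqrt d"] d by (intro mult_left_mono) auto
  finally have IG: "(\<integral>u. G u \<partial>area) \<le> 2 * pi * (1 / sqrt d)" by simp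
  \<comment> \<open>Taylor coefficients of (1 + v)/(1 - v) = 1 + 2 v + 2 v^2 + ..., with v = conj(x)
    u.\<close>
  define h where "h = (\<lambda>k::nat. if k = 0 then 1 else 2 * cnj x ^ k)"
  have hs: "(\<lambda>k. h k * u ^ k) sums ((1 + cnj x * u) / (1 - cnj x * u))" if "u \<in> disc" for u
  proof -
    have v: "cmod (cnj x * u) < 1" by (rule norm_mult_cnj_less_1[OF x that])
    then have nz: "1 - cnj x * u \<noteq> 0" by auto
    have "(\<lambda>k. 2 * (cnj x * u) ^ k) sums (2 * (1 / (1 - cnj x * u)))"
      by (intro sums_mult geometric_sums v)
    moreover have "(\<lambda>k. if k = 0 then -1 else (0::complex)) sums (- 1)"
      using sums_single[of 0 "\<lambda>_. -1::complex"] by simp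
    ultimately have "(\<lambda>k. 2 * (cnj x * u) ^ k + (if k = 0 then -1 else 0)) sums (2 * (1 / (1 - cnj x * u)) + (-1))"
      by (rule sums_add)
    moreover have "2 * (1 / (1 - cnj x * u)) + (-1) = (1 + cnj x * u) / (1 - cnj x * u)"
      using nz by (simp add: field_simps)
    moreover have "2 * (cnj x * u) ^ k + (if k = 0 then -1 else 0) = h k * u ^ k" for k
      by (simp add: h_def power_mult_distrib)
    ultimately show ?thesis by simp
  qed
  have sh: "summable (\<lambda>k. cmod (h k))"
  proof (rule summable_comparison_test')
    show "summable (\<lambda>k. 2 * cmod x ^ k)" using x by (intro summable_mult summable_geometric) simp
    show "norm (cmod (h k)) \<le> 2 * cmod x ^ k" for k by (simp add: h_def norm_mult norm_power)
  qed
  have Grot: "G (c * z) = G z" if "cmod c = 1" for c z using that by (simp add: G_def norm_mult)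
  \<comment> \<open>Pairing with the zeroth power extracts the constant coefficient, which is
    1.\<close>
  note P = integral_power_series_cnj_power[OF iG Grot sh, of 0]
  let ?f = "\<lambda>z. of_real (G z) * (\<Sum>k. h k * z ^ k)"
  have int: "integrable area ?f" using P(1) by simp
  have "(\<integral>z. ?f z \<partial>area) = of_real (\<integral>z. G z \<partial>area)" using P(2) by (simp add: h_def)
  then have R: "(\<integral>z. Re (?f z) \<partial>area) = (\<integral>z. G z \<partial>area)"
    using integral_Re[OF int] by simp
  have eq: "AE u in area. kern x u * (1 / sqrt (1 - (cmod u)\<^sup>2)) = Re (?f u)"
    using AE_area
  proof eventually_elim
    case (elim u)
    have "Re (of_real r * z) = r * Re z" for r z by simp
    then have "Re (?f u) = G u * Re ((1 + cnj x * u) / (1 - cnj x * u))"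
      using sums_unique[OF hs[OF elim]] by (simp only:)
    then show ?case by (simp only: kern_poisson[OF x elim] G_def r_def) (simp add: mult.commute)
  qed
  have "(\<integral>\<^sup>+u. ennreal (kern x u * (1 / sqrt (1 - (cmod u)\<^sup>2))) \<partial>area) = (\<integral>\<^sup>+u. ennreal (Re (?f u)) \<partial>area)"
    by (rule nn_integral_cong_AE) (use eq in eventually_elim, simp)
  also have "\<dots> = ennreal (\<integral>z. Re (?f z) \<partial>area)"
  proof (rule nn_integral_eq_integral)
    show "integrable area (\<lambda>z. Re (?f z))" by (rule integrable_Re[OF int])
    show "AE z in area. 0 \<le> Re (?f z)"
      using eq AE_area
    proof eventually_elim
      case (elim z)
      have "0 \<le> kern x z * (1 / sqrt (1 - (cmod z)\<^sup>2))" using elim(2) by (simp add: power_le_one)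
      then show ?case using elim(1) by (simp only:)
    qed
  qed
  also have "\<dots> \<le> ennreal (2 * pi * (1 / sqrt (1 - (cmod x)\<^sup>2)))"
    using IG R by (intro ennreal_leI) (simp add: d_def r_def)
  finally show ?thesis .
qed

text \<open>The positive Bergman operator, with values in \<open>ennreal\<close> so that it can be
  iterated and squared before any finiteness is known.\<close>

definition Pplus :: "(complex \<Rightarrow> ennreal) \<Rightarrow> complex \<Rightarrow> ennreal" where
  "Pplus F x = (\<integral>\<^sup>+u. ennreal (kern x u) * F u \<partial>area)"

lemma measurable_Pplus [measurable]:
  assumes [measurable]: "F \<in> borel_measurable borel"
  shows "Pplus F \<in> borel_measurable borel"
  unfolding Pplus_def by measurable

text \<open>Schur test: with F = h G, Cauchy-Schwarz splits the integrand evenly over sqrt(kern h).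
  Integrating one factor costs 2 pi h(x); exchanging the integrals and using the symmetry of
  \<open>kern\<close> costs another 2 pi. The operator norm is thus at most 2 pi.\<close>

lemma Pplus_L2:
  assumes [measurable]: "F \<in> borel_measurable borel"
  shows "(\<integral>\<^sup>+x. (Pplus F x)\<^sup>2 \<partial>area) \<le> ennreal (4 * pi\<^sup>2) * (\<integral>\<^sup>+x. (F x)\<^sup>2 \<partial>area)"
proof -
  define s where "s = (\<lambda>u::complex. sqrt (1 - (cmod u)\<^sup>2))"
  \<comment> \<open>Outside the disc \<open>sqrt\<close> is negative or zero; the absolute value
    keeps the weight nonnegative everywhere.\<close>
  define h where "h = (\<lambda>u::complex. \<bar>1 / s u\<bar>)"
  have [measurable]: "s \<in> borel_measurable borel" "h \<in> borel_measurable borel"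
    unfolding h_def s_def by measurable
  have s: "0 < s u" if "u \<in> disc" for u using that by (simp add: s_def power_less_one_iff)
  have h: "h u = 1 / s u" if "u \<in> disc" for u using s[OF that] by (simp add: h_def)
  have hnn: "0 \<le> h u" for u by (simp add: h_def)
  have hs: "ennreal (h u) * ennreal (s u) = 1" if "u \<in> disc" for u
    using s[OF that] by (simp add: h[OF that] ennreal_mult''[symmetric])
  define G where "G = (\<lambda>u. ennreal (s u) * F u)"
  have [measurable]: "G \<in> borel_measurable borel" unfolding G_def by measurable
  have F: "F u = ennreal (h u) * G u" if "u \<in> disc" for u
    using hs[OF that] by (simp add: G_def mult.assoc[symmetric])
  have schur: "(\<integral>\<^sup>+u. ennreal (kern x u * h u) \<partial>area) \<le> ennreal (2 * pi * h x)" if "x \<in> disc" for x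
  proof -
    have "(\<integral>\<^sup>+u. ennreal (kern x u * h u) \<partial>area) = (\<integral>\<^sup>+u. ennreal (kern x u * (1 / sqrt (1 - (cmod u)\<^sup>2))) \<partial>area)"
      by (rule nn_integral_cong_AE) (use AE_area in eventually_elim, simp add: h s_def)
    then show ?thesis using kern_schur[OF that] h[OF that] by (simp add: s_def)
  qed
  have pt: "(Pplus F x)\<^sup>2 \<le> ennreal (2 * pi) * (\<integral>\<^sup>+u. ennreal (h x) * ennreal (kern x u * h u) * (G u)\<^sup>2 \<partial>area)"
    if x: "x \<in> disc" for x
  proof -
    let ?q = "\<lambda>u. ennreal (sqrt (kern x u * h u))"
    have q2: "(?q u)\<^sup>2 = ennreal (kern x u * h u)" for u
      using hnn[of u] by (simp add: ennreal_power)
    have "Pplus F x = (\<integral>\<^sup>+u. ?q u * (?q u * G u) \<partial>area)"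
      unfolding Pplus_def
    proof (rule nn_integral_cong_AE)
      show "AE u in area. ennreal (kern x u) * F u = ?q u * (?q u * G u)"
        using AE_area
      proof eventually_elim
        case (elim u)
        have "?q u * (?q u * G u) = (?q u)\<^sup>2 * G u" by (simp add: power2_eq_square mult.assoc)
        then show ?case by (simp add: q2 F[OF elim] ennreal_mult' hnn mult.assoc)
      qed
    qed
    then have "(Pplus F x)\<^sup>2 \<le> (\<integral>\<^sup>+u. (?q u)\<^sup>2 \<partial>area) * (\<integral>\<^sup>+u. (?q u * G u)\<^sup>2 \<partial>area)"
      by (simp only:) (rule Cauchy_Schwarz_nn_integral; measurable)
    also have "\<dots> \<le> ennreal (2 * pi * h x) * (\<integral>\<^sup>+u. ennreal (kern x u * h u) * (G u)\<^sup>2 \<partial>area)"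
      unfolding power_mult_distrib q2 by (intro mult_right_mono schur x) simp
    also have "\<dots> = ennreal (2 * pi) * (\<integral>\<^sup>+u. ennreal (h x) * (ennreal (kern x u * h u) * (G u)\<^sup>2) \<partial>area)"
      by (subst nn_integral_cmult) (simp_all add: ennreal_mult' hnn mult.assoc)
    finally show ?thesis by (simp add: mult.assoc)
  qed
  have "(\<integral>\<^sup>+x. (Pplus F x)\<^sup>2 \<partial>area)
      \<le> (\<integral>\<^sup>+x. ennreal (2 * pi) * (\<integral>\<^sup>+u. ennreal (h x) * ennreal (kern x u * h u) * (G u)\<^sup>2 \<partial>area) \<partial>area)"
    by (rule nn_integral_mono_AE) (use AE_area pt in \<open>auto elim: eventually_mono\<close>)
  also have "\<dots> = ennreal (2 * pi) * (\<integral>\<^sup>+x. (\<integral>\<^sup>+u. ennreal (h x) * ennreal (kern x u * h u) * (G u)\<^sup>2 \<partial>area) \<partial>area)"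
    by (rule nn_integral_cmult) measurable
  also have "(\<integral>\<^sup>+x. (\<integral>\<^sup>+u. ennreal (h x) * ennreal (kern x u * h u) * (G u)\<^sup>2 \<partial>area) \<partial>area)
      = (\<integral>\<^sup>+u. (\<integral>\<^sup>+x. ennreal (h x) * ennreal (kern x u * h u) * (G u)\<^sup>2 \<partial>area) \<partial>area)"
    by (rule area_pair.Fubini') measurable
  also have "\<dots> \<le> (\<integral>\<^sup>+u. ennreal (2 * pi) * (F u)\<^sup>2 \<partial>area)"
  proof (rule nn_integral_mono_AE)
    show "AE u in area. (\<integral>\<^sup>+x. ennreal (h x) * ennreal (kern x u * h u) * (G u)\<^sup>2 \<partial>area) \<le> ennreal (2 * pi) * (F u)\<^sup>2"
      using AE_area
    proof eventually_elim
      case (elim u)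
      have "(\<integral>\<^sup>+x. ennreal (h x) * ennreal (kern x u * h u) * (G u)\<^sup>2 \<partial>area)
          = (\<integral>\<^sup>+x. (ennreal (h u) * (G u)\<^sup>2) * ennreal (kern u x * h x) \<partial>area)"
        by (rule nn_integral_cong) (simp add: kern_commute[of _ u] ennreal_mult' hnn mult_ac)
      also have "\<dots> = (ennreal (h u) * (G u)\<^sup>2) * (\<integral>\<^sup>+x. ennreal (kern u x * h x) \<partial>area)"
        by (rule nn_integral_cmult) measurable
      also have "\<dots> \<le> (ennreal (h u) * (G u)\<^sup>2) * ennreal (2 * pi * h u)"
        by (intro mult_left_mono schur elim) simp
      also have "\<dots> = ennreal (2 * pi) * (F u)\<^sup>2"
        by (simp add: F[OF elim] power2_eq_square ennreal_mult' hnn mult_ac)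
      finally show ?case .
    qed
  qed
  also have "\<dots> = ennreal (2 * pi) * (\<integral>\<^sup>+u. (F u)\<^sup>2 \<partial>area)"
    by (rule nn_integral_cmult) measurable
  finally have "(\<integral>\<^sup>+x. (Pplus F x)\<^sup>2 \<partial>area) \<le> ennreal (2 * pi) * (ennreal (2 * pi) * (\<integral>\<^sup>+u. (F u)\<^sup>2 \<partial>area))"
    by (simp add: mult_left_mono)
  also have "\<dots> = ennreal (4 * pi\<^sup>2) * (\<integral>\<^sup>+x. (F x)\<^sup>2 \<partial>area)"
  proof -
    have "ennreal (2 * pi) * ennreal (2 * pi) = ennreal (4 * pi\<^sup>2)"
      by (simp add: ennreal_mult'[symmetric] power2_eq_square mult_ac)
    then show ?thesis by (simp add: mult.assoc[symmetric])
  qed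
  finally show ?thesis .
qed

section \<open>The Bergman space and its normalized kernels\<close>

lemma one_minus_cnj_mult_nonzero:
  assumes "z \<in> disc" "w \<in> disc"
  shows "1 - cnj z * w \<noteq> 0"
  using norm_mult_cnj_less_1[OF assms] by auto

text \<open>Polarized form of the identity for 1 - |phi_z(x)|^2. The case x = u gives the
  pseudohyperbolic formula; the general case identifies the averaged kernel with a power of 1 -
  phi(x) conj(phi(u)).\<close>

lemma one_minus_phi_mult_cnj_phi:
  assumes "z \<in> disc" "x \<in> disc" "u \<in> disc"
  shows "1 - phi z x * cnj (phi z u)
    = of_real (1 - (cmod z)\<^sup>2) * (1 - x * cnj u) / ((1 - cnj z * x) * (1 - z * cnj u))"
proof -
  have nz: "1 - cnj z * x \<noteq> 0" "1 - cnj z * u \<noteq> 0"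
    by (rule one_minus_cnj_mult_nonzero[OF assms(1,2)], rule one_minus_cnj_mult_nonzero[OF assms(1,3)])
  have "cnj (1 - cnj z * u) \<noteq> 0" using nz(2) by (simp only: complex_cnj_zero_iff not_False_eq_True)
  then have nz3: "1 - z * cnj u \<noteq> 0" by simp
  have eq: "of_real (1 - (cmod z)\<^sup>2) = 1 - z * cnj z"
    by (simp only: of_real_diff of_real_1 complex_norm_square)
  have "1 - P / A * (Q / B) = (A * B - P * Q) / (A * B)" if "A \<noteq> 0" "B \<noteq> 0" for A B P Q :: complex
    using that by (simp add: diff_divide_distrib)
  note frac = this[OF nz(1) nz3, of "z - x" "cnj z - cnj u"]
  have "(1 - cnj z * x) * (1 - z * cnj u) - (z - x) * (cnj z - cnj u) = (1 - z * cnj z) * (1 - x * cnj u)"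
    by (simp add: algebra_simps)
  then show ?thesis unfolding eq phi_def using frac by simp
qed

lemma one_minus_norm_phi_sq:
  assumes "z \<in> disc" "w \<in> disc"
  shows "1 - (cmod (phi z w))\<^sup>2 = (1 - (cmod z)\<^sup>2) * (1 - (cmod w)\<^sup>2) / (cmod (1 - cnj z * w))\<^sup>2"
proof -
  have "(1 - cnj z * w) * (1 - z * cnj w) = of_real ((cmod (1 - cnj z * w))\<^sup>2)"
    by (simp only: complex_norm_square) simp
  moreover have "1 - w * cnj w = of_real (1 - (cmod w)\<^sup>2)"
    by (simp only: of_real_diff of_real_1 complex_norm_square)
  moreover have "1 - phi z w * cnj (phi z w) = of_real (1 - (cmod (phi z w))\<^sup>2)"
    by (simp only: of_real_diff of_real_1 complex_norm_square)
  ultimately have "complex_of_real (1 - (cmod (phi z w))\<^sup>2)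
      = of_real ((1 - (cmod z)\<^sup>2) * (1 - (cmod w)\<^sup>2) / (cmod (1 - cnj z * w))\<^sup>2)"
    using one_minus_phi_mult_cnj_phi[OF assms assms(2)] by (simp only: of_real_mult of_real_divide)
  then show ?thesis by (simp only: of_real_eq_iff)
qed

lemma one_minus_norm_sq_pos: "z \<in> disc \<Longrightarrow> 0 < 1 - (cmod z)\<^sup>2"
  by (simp add: power_less_one_iff)

lemma norm_phi_less_1:
  assumes "z \<in> disc" "w \<in> disc"
  shows "cmod (phi z w) < 1"
proof -
  have "0 < 1 - (cmod (phi z w))\<^sup>2"
    unfolding one_minus_norm_phi_sq[OF assms]
    using assms one_minus_cnj_mult_nonzero[OF assms] by (intro divide_pos_pos mult_pos_pos one_minus_norm_sq_pos) auto
  then show ?thesis by (simp add: power_less_one_iff)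
qed

text \<open>This is artanh r >= r, from the derivative 1/(1+x) + 1/(1-x) - 2 >= 0. It turns a
  Lipschitz bound in |phi_z(w)| into one in the hyperbolic metric.\<close>

lemma hyp_dist_ge_norm_phi:
  assumes "z \<in> disc" "w \<in> disc"
  shows "cmod (phi z w) \<le> hyp_dist z w"
proof -
  define r where "r = cmod (phi z w)"
  have r: "0 \<le> r" "r < 1" using norm_phi_less_1[OF assms] by (auto simp: r_def)
  have "ln (1 + r) - ln (1 - r) \<ge> 2 * r"
  proof -
    have "(\<lambda>x. ln (1 + x) - ln (1 - x) - 2 * x) 0 \<le> (\<lambda>x. ln (1 + x) - ln (1 - x) - 2 * x) r"
    proof (rule DERIV_nonneg_imp_nondecreasing[OF r(1)])
      fix x assume x: "0 \<le> x" "x \<le> r"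
      have p: "0 < 1 + x" "0 < 1 - x" using x r by auto
      have "((\<lambda>x. ln (1 + x) - ln (1 - x) - 2 * x) has_real_derivative 1 / (1 + x) + 1 / (1 - x) - 2) (at x)"
        using p by (auto intro!: derivative_eq_intros)
      moreover have "0 \<le> 1 / (1 + x) + 1 / (1 - x) - 2"
      proof -
        have "1 / (1 + x) + 1 / (1 - x) = 2 / ((1 + x) * (1 - x))"
          using p by (simp add: add_frac_eq)
        moreover have "(1 + x) * (1 - x) \<le> 1" by (simp add: algebra_simps)
        moreover have "0 < (1 + x) * (1 - x)" using p by simp
        ultimately show ?thesis by (simp add: le_divide_eq)
      qed
      ultimately show "\<exists>y. ((\<lambda>x. ln (1 + x) - ln (1 - x) - 2 * x) has_real_derivative y) (at x) \<and> 0 \<le> y"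
        by blast
    qed
    then show ?thesis by simp
  qed
  then show ?thesis using r by (simp add: hyp_dist_def r_def[symmetric] ln_div)
qed

text \<open>This is minus the normalized kernel k_z, since the derivative of phi_z carries a sign.
  The sign disappears in the Berezin transform, where the function occurs twice.\<close>

lemma U_op_e0:
  assumes z: "z \<in> disc"
  shows "U_op z e0 = (\<lambda>w. if w \<in> disc then - of_real (1 - (cmod z)\<^sup>2) / (1 - cnj z * w)\<^sup>2 else 0)"
proof
  fix w
  have "deriv (phi z) w = - of_real (1 - (cmod z)\<^sup>2) / (1 - cnj z * w)\<^sup>2" if w: "w \<in> disc"
  proof (rule DERIV_imp_deriv)
    have "of_real (1 - (cmod z)\<^sup>2) = 1 - z * cnj z"
      by (simp only: of_real_diff of_real_1 complex_norm_square)
    then show "(phi z has_field_derivative - of_real (1 - (cmod z)\<^sup>2) / (1 - cnj z * w)\<^sup>2) (at w)"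
      unfolding phi_def using one_minus_cnj_mult_nonzero[OF z w]
      by (auto intro!: derivative_eq_intros simp: power2_eq_square algebra_simps)
  qed
  then show "U_op z e0 w = (if w \<in> disc then - of_real (1 - (cmod z)\<^sup>2) / (1 - cnj z * w)\<^sup>2 else 0)"
    using norm_phi_less_1[OF z] by (simp add: U_op_def e0_def)
qed

lemma bergman_space_measurable:
  assumes "f \<in> bergman_space"
  shows "f \<in> borel_measurable borel"
proof -
  have "(\<lambda>x. indicator disc x *\<^sub>R f x) \<in> borel_measurable borel"
    using assms by (intro borel_measurable_continuous_on_indicator holomorphic_on_imp_continuous_on)
      (auto simp: bergman_space_def)
  also have "(\<lambda>x. indicator disc x *\<^sub>R f x) = f"
    using assms by (auto simp: fun_eq_iff bergman_space_def indicator_def)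
  finally show ?thesis .
qed

lemma integrable_area_vanishing:
  fixes f :: "complex \<Rightarrow> 'b :: {banach, second_countable_topology}"
  assumes "f \<in> borel_measurable borel" "\<And>w. w \<notin> disc \<Longrightarrow> f w = 0"
  shows "integrable area f \<longleftrightarrow> integrable lborel f"
proof -
  have "(\<lambda>w. (indicator disc w / pi) *\<^sub>R f w) = (\<lambda>w. (1 / pi) *\<^sub>R f w)"
    using assms(2) by (auto simp: fun_eq_iff indicator_def)
  moreover have "integrable lborel (\<lambda>w. (1 / pi) *\<^sub>R f w) \<longleftrightarrow> integrable lborel f"
    using integrable_scaleR_right[of "1 / pi" lborel f]
      integrable_scaleR_right[of pi lborel "\<lambda>w. (1 / pi) *\<^sub>R f w"] by auto
  ultimately show ?thesis by (simp only: integrable_area[OF assms(1)])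
qed

lemma bergman_space_iff:
  "f \<in> bergman_space \<longleftrightarrow> f holomorphic_on disc \<and> (\<forall>w. w \<notin> disc \<longrightarrow> f w = 0)
     \<and> f \<in> borel_measurable borel \<and> integrable area (\<lambda>w. (cmod (f w))\<^sup>2)"
  using bergman_space_measurable[of f] integrable_area_vanishing[of "\<lambda>w. (cmod (f w))\<^sup>2"]
  by (auto simp: bergman_space_def)

lemma berg_inner_area:
  assumes [measurable]: "f \<in> borel_measurable borel" "g \<in> borel_measurable borel"
  shows "berg_inner f g = (\<integral>w. f w * cnj (g w) \<partial>area)"
proof -
  have "(\<integral>w. f w * cnj (g w) \<partial>area) = (\<integral>w. (1 / pi) *\<^sub>R (indicator disc w *\<^sub>R (f w * cnj (g w))) \<partial>lborel)"
    by (subst integral_area) (auto intro!: Bochner_Integration.integral_cong)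
  also have "\<dots> = (1 / pi) *\<^sub>R (\<integral>w. indicator disc w *\<^sub>R (f w * cnj (g w)) \<partial>lborel)"
    by (rule integral_scaleR_right)
  finally show ?thesis by (simp add: berg_inner_def set_lebesgue_integral_def scaleR_conv_of_real)
qed

lemma berg_norm_area:
  assumes [measurable]: "f \<in> borel_measurable borel"
  shows "berg_norm f = sqrt (\<integral>w. (cmod (f w))\<^sup>2 \<partial>area)"
proof -
  have "berg_inner f f = of_real (\<integral>w. (cmod (f w))\<^sup>2 \<partial>area)"
    by (simp add: berg_inner_area complex_norm_square[symmetric] del: of_real_power)
  then show ?thesis by (simp add: berg_norm_def)
qed

lemma berg_norm_nonneg [simp]: "f \<in> bergman_space \<Longrightarrow> 0 \<le> berg_norm f"
  by (simp add: berg_norm_area bergman_space_measurable)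

lemma nn_integral_norm_sq:
  assumes "f \<in> bergman_space"
  shows "(\<integral>\<^sup>+w. (ennreal (cmod (f w)))\<^sup>2 \<partial>area) = ennreal ((berg_norm f)\<^sup>2)"
  using assms by (simp add: ennreal_power nn_integral_eq_integral bergman_space_iff berg_norm_area)

lemma norm_integral_le_nn_integral:
  fixes f :: "_ \<Rightarrow> 'b :: {banach, second_countable_topology}"
  shows "ennreal (norm (\<integral>x. f x \<partial>M)) \<le> (\<integral>\<^sup>+x. ennreal (norm (f x)) \<partial>M)"
  by (cases "integrable M f") (auto simp: integral_norm_bound_ennreal not_integrable_integral_eq)

lemma berg_inner_Cauchy_Schwarz:
  assumes f: "f \<in> bergman_space" and g: "g \<in> bergman_space"
  shows "cmod (berg_inner f g) \<le> berg_norm f * berg_norm g"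
proof -
  note [measurable] = bergman_space_measurable[OF f] bergman_space_measurable[OF g]
  have "ennreal (cmod (berg_inner f g)) \<le> (\<integral>\<^sup>+w. ennreal (cmod (f w)) * ennreal (cmod (g w)) \<partial>area)"
    using norm_integral_le_nn_integral[of area "\<lambda>w. f w * cnj (g w)"]
    by (simp add: berg_inner_area norm_mult ennreal_mult')
  then have "(ennreal (cmod (berg_inner f g)))\<^sup>2 \<le> (\<integral>\<^sup>+w. ennreal (cmod (f w)) * ennreal (cmod (g w)) \<partial>area)\<^sup>2"
    by (rule power_mono) simp
  also have "\<dots> \<le> (\<integral>\<^sup>+w. (ennreal (cmod (f w)))\<^sup>2 \<partial>area) * (\<integral>\<^sup>+w. (ennreal (cmod (g w)))\<^sup>2 \<partial>area)"
    by (rule Cauchy_Schwarz_nn_integral) measurable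
  finally have "(cmod (berg_inner f g))\<^sup>2 \<le> (berg_norm f * berg_norm g)\<^sup>2"
    unfolding nn_integral_norm_sq[OF f] nn_integral_norm_sq[OF g]
    by (simp add: ennreal_power ennreal_mult'[symmetric] power_mult_distrib)
  then show ?thesis
    by (rule power2_le_imp_le) (use f g in simp)
qed

lemma bergman_space_integrable_mult:
  assumes f: "f \<in> bergman_space" and g: "g \<in> bergman_space"
  shows "integrable area (\<lambda>w. f w * cnj (g w))"
proof (rule Bochner_Integration.integrable_bound)
  note [measurable] = bergman_space_measurable[OF f] bergman_space_measurable[OF g]
  show "integrable area (\<lambda>w. (cmod (f w))\<^sup>2 + (cmod (g w))\<^sup>2)"
    using f g by (simp add: bergman_space_iff)
  show "(\<lambda>w. f w * cnj (g w)) \<in> borel_measurable area" by measurable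
  have "x * y \<le> x\<^sup>2 + y\<^sup>2" if "0 \<le> x" "0 \<le> y" for x y :: real
    using sum_squares_bound[of x y] that mult_nonneg_nonneg[OF that] by linarith
  then show "AE w in area. norm (f w * cnj (g w)) \<le> norm ((cmod (f w))\<^sup>2 + (cmod (g w))\<^sup>2)"
    by (auto simp: norm_mult)
qed

lemma bergman_space_lincomb:
  assumes f: "f \<in> bergman_space" and g: "g \<in> bergman_space"
  shows "(\<lambda>w. a * f w + b * g w) \<in> bergman_space"
proof -
  note [measurable] = bergman_space_measurable[OF f] bergman_space_measurable[OF g]
  have "integrable area (\<lambda>w. (cmod (a * f w + b * g w))\<^sup>2)"
  proof (rule Bochner_Integration.integrable_bound)
    show "integrable area (\<lambda>w. 2 * (cmod a)\<^sup>2 * (cmod (f w))\<^sup>2 + 2 * (cmod b)\<^sup>2 * (cmod (g w))\<^sup>2)"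
      using f g by (simp add: bergman_space_iff)
    show "AE w in area. norm ((cmod (a * f w + b * g w))\<^sup>2)
        \<le> norm (2 * (cmod a)\<^sup>2 * (cmod (f w))\<^sup>2 + 2 * (cmod b)\<^sup>2 * (cmod (g w))\<^sup>2)"
    proof (rule AE_I2)
      fix w
      have "(cmod (a * f w + b * g w))\<^sup>2 \<le> (cmod a * cmod (f w) + cmod b * cmod (g w))\<^sup>2"
        by (intro power_mono) (auto intro: norm_triangle_le simp: norm_mult)
      also have "\<dots> \<le> 2 * (cmod a * cmod (f w))\<^sup>2 + 2 * (cmod b * cmod (g w))\<^sup>2"
        using sum_squares_bound[of "cmod a * cmod (f w)" "cmod b * cmod (g w)"] by (simp add: power2_sum)
      finally show "norm ((cmod (a * f w + b * g w))\<^sup>2)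
        \<le> norm (2 * (cmod a)\<^sup>2 * (cmod (f w))\<^sup>2 + 2 * (cmod b)\<^sup>2 * (cmod (g w))\<^sup>2)"
        by (simp add: power_mult_distrib)
    qed
  qed measurable
  moreover have "(\<lambda>w. a * f w + b * g w) holomorphic_on disc"
    using f g by (intro holomorphic_intros) (auto simp: bergman_space_def)
  moreover have "\<forall>w. w \<notin> disc \<longrightarrow> a * f w + b * g w = 0"
    using f g by (auto simp: bergman_space_def)
  ultimately show ?thesis by (simp add: bergman_space_iff)
qed

text \<open>Supplies the radius beyond 1 required by the reproducing formula. The witness R = 2/(1 +
  |z|) exceeds 1 and satisfies |z| R < 1.\<close>

lemma one_minus_cnj_mult_nonzero_ball:
  assumes "z \<in> disc"
  shows "\<exists>R>1. \<forall>u\<in>ball 0 R. 1 - cnj z * u \<noteq> 0"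
proof -
  define R where "R = 2 / (1 + cmod z)"
  have "1 < R" using assms by (simp add: R_def add_pos_nonneg)
  moreover have "1 - cnj z * u \<noteq> 0" if u: "u \<in> ball 0 R" for u
  proof -
  have "cmod (cnj z * u) \<le> cmod z * R"
    using u by (auto simp: norm_mult intro!: mult_left_mono)
  also have "\<dots> < 1" using assms by (simp add: R_def divide_simps add_pos_nonneg)
  finally show ?thesis by auto
  qed
  ultimately show ?thesis by blast
qed

lemma U_op_e0_measurable:
  assumes w: "w \<in> disc" shows "U_op w e0 \<in> borel_measurable borel"
  unfolding U_op_e0[OF w] by (rule measurable_If) auto

text \<open>The unweighted case n = 0 of the reproducing formula; the minus sign is that of
  \<open>U_op w e0\<close>.\<close>

lemma reproducing_U_op_e0:
  assumes h: "h holomorphic_on ball 0 R" "1 < R" "h \<in> borel_measurable borel" and w: "w \<in> disc"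
  shows "(\<integral>u. h u * cnj (U_op w e0 u) \<partial>area) = - of_real (1 - (cmod w)\<^sup>2) * h w"
proof -
  note [measurable] = h(3)
  have "(\<integral>u. h u * cnj (U_op w e0 u) \<partial>area)
    = (\<integral>u. - of_real (1 - (cmod w)\<^sup>2) * (of_real ((1 - (cmod u)\<^sup>2) ^ 0) * h u * cnj (1 / (1 - cnj w * u) ^ (0 + 2))) \<partial>area)"
  proof (rule integral_cong_AE)
    show "AE u in area. h u * cnj (U_op w e0 u)
      = - of_real (1 - (cmod w)\<^sup>2) * (of_real ((1 - (cmod u)\<^sup>2) ^ 0) * h u * cnj (1 / (1 - cnj w * u) ^ (0 + 2)))"
      using AE_area by eventually_elim (simp add: U_op_e0[OF w] power2_eq_square mult.commute)
    show "(\<lambda>u. h u * cnj (U_op w e0 u)) \<in> borel_measurable area"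
      using U_op_e0_measurable[OF w] by measurable
  qed measurable
  also have "\<dots> = - of_real (1 - (cmod w)\<^sup>2) * (\<integral>u. of_real ((1 - (cmod u)\<^sup>2) ^ 0) * h u * cnj (1 / (1 - cnj w * u) ^ (0 + 2)) \<partial>area)"
    by (rule integral_mult_right_zero)
  also have "(\<integral>u. of_real ((1 - (cmod u)\<^sup>2) ^ 0) * h u * cnj (1 / (1 - cnj w * u) ^ (0 + 2)) \<partial>area) = h w"
    using weighted_reproducing[OF h w, of 0] by simp
  finally show ?thesis .
qed

lemma integral_U_op_e0_U_op_e0:
  assumes z: "z \<in> disc" and w: "w \<in> disc"
  shows "(\<integral>u. U_op z e0 u * cnj (U_op w e0 u) \<partial>area)
    = of_real ((1 - (cmod z)\<^sup>2) * (1 - (cmod w)\<^sup>2)) / (1 - cnj z * w)\<^sup>2"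
proof -
  note [measurable] = U_op_e0_measurable[OF z] U_op_e0_measurable[OF w]
  define h where "h = (\<lambda>u. - of_real (1 - (cmod z)\<^sup>2) / (1 - cnj z * u)\<^sup>2)"
  obtain R where R: "1 < R" "\<And>u. u \<in> ball 0 R \<Longrightarrow> 1 - cnj z * u \<noteq> 0"
    using one_minus_cnj_mult_nonzero_ball[OF z] by blast
  have "h holomorphic_on ball 0 R"
    unfolding h_def using R by (intro holomorphic_intros) auto
  moreover have [measurable]: "h \<in> borel_measurable borel" unfolding h_def by measurable
  ultimately have "(\<integral>u. h u * cnj (U_op w e0 u) \<partial>area) = - of_real (1 - (cmod w)\<^sup>2) * h w"
    using R(1) w by (intro reproducing_U_op_e0)
  moreover have "(\<integral>u. U_op z e0 u * cnj (U_op w e0 u) \<partial>area) = (\<integral>u. h u * cnj (U_op w e0 u) \<partial>area)"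
    by (rule integral_cong_AE) (use AE_area in \<open>auto elim: eventually_mono simp: U_op_e0[OF z] h_def\<close>)
  moreover have "- of_real b * (- of_real a / d) = complex_of_real (a * b) / d" for a b d by simp
  ultimately show ?thesis by (simp only: h_def)
qed

lemma U_op_e0_bergman_space:
  assumes z: "z \<in> disc"
  shows "U_op z e0 \<in> bergman_space"
proof -
  have "(\<lambda>w. - of_real (1 - (cmod z)\<^sup>2) / (1 - cnj z * w)\<^sup>2) holomorphic_on disc"
    using one_minus_cnj_mult_nonzero[OF z] by (intro holomorphic_intros) auto
  then have "U_op z e0 holomorphic_on disc"
    by (rule holomorphic_transform) (simp add: U_op_e0[OF z])
  moreover have "integrable area (\<lambda>w. (cmod (U_op z e0 w))\<^sup>2)"
  proof (rule norm_le_integrable_area)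
    fix w :: complex assume w: "w \<in> disc"
    have "1 - cmod z \<le> cmod (1 - cnj z * w)"
    proof -
      have "cmod (cnj z * w) \<le> cmod z" using w by (simp add: norm_mult mult_left_le)
      then show ?thesis using norm_triangle_ineq2[of 1 "cnj z * w"] by simp
    qed
    then have "(1 - cmod z)\<^sup>2 \<le> (cmod (1 - cnj z * w))\<^sup>2" using z by (intro power_mono) auto
    then have "(1 - (cmod z)\<^sup>2) / (cmod (1 - cnj z * w))\<^sup>2 \<le> (1 - (cmod z)\<^sup>2) / (1 - cmod z)\<^sup>2"
      using z one_minus_norm_sq_pos[OF z] one_minus_cnj_mult_nonzero[OF z w]
      by (intro divide_left_mono) (auto intro!: mult_pos_pos)
    moreover have "cmod (U_op z e0 w) = (1 - (cmod z)\<^sup>2) / (cmod (1 - cnj z * w))\<^sup>2"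
      using one_minus_norm_sq_pos[OF z] w
      by (simp add: U_op_e0[OF z] norm_divide norm_power del: of_real_diff of_real_power)
    ultimately show "norm ((cmod (U_op z e0 w))\<^sup>2) \<le> ((1 - (cmod z)\<^sup>2) / (1 - cmod z)\<^sup>2)\<^sup>2"
      using one_minus_norm_sq_pos[OF z] by (simp add: power_mono)
  qed (use U_op_e0_measurable[OF z] in measurable)
  ultimately show ?thesis
    using U_op_e0_measurable[OF z] by (auto simp: bergman_space_iff U_op_e0[OF z])
qed

lemma berg_norm_U_op_e0:
  assumes z: "z \<in> disc"
  shows "berg_norm (U_op z e0) = 1"
proof -
  have "complex_of_real ((1 - (cmod z)\<^sup>2) * (1 - (cmod z)\<^sup>2)) = (1 - cnj z * z)\<^sup>2"
  proof -
    have "complex_of_real (1 - (cmod z)\<^sup>2) = 1 - cnj z * z"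
      by (simp only: of_real_diff of_real_1 complex_norm_square mult.commute)
    then show ?thesis by (simp only: of_real_mult power2_eq_square)
  qed
  then have "berg_inner (U_op z e0) (U_op z e0) = 1"
    using one_minus_cnj_mult_nonzero[OF z z]
    by (simp only: berg_inner_area[OF U_op_e0_measurable[OF z] U_op_e0_measurable[OF z]] integral_U_op_e0_U_op_e0[OF z z]) simp
  then show ?thesis by (simp add: berg_norm_def)
qed

text \<open>This is where pseudohyperbolic distance enters: it measures how far two normalized
  kernels are from being parallel.\<close>

lemma norm_berg_inner_U_op_e0:
  assumes z: "z \<in> disc" and w: "w \<in> disc"
  shows "cmod (berg_inner (U_op z e0) (U_op w e0)) = 1 - (cmod (phi z w))\<^sup>2"
proof -
  have "0 \<le> (1 - (cmod z)\<^sup>2) * (1 - (cmod w)\<^sup>2)"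
    using one_minus_norm_sq_pos[OF z] one_minus_norm_sq_pos[OF w] by simp
  then show ?thesis
    by (simp only: berg_inner_area[OF U_op_e0_measurable[OF z] U_op_e0_measurable[OF w]] integral_U_op_e0_U_op_e0[OF z w]
      norm_divide norm_power norm_of_real abs_of_nonneg one_minus_norm_phi_sq[OF z w])
qed

section \<open>Berezin transforms are uniformly continuous\<close>

text \<open>A unimodular factor on the kernel does not change the Berezin transform, so the kernels
  may be aligned first. Replacing them one slot at a time in the quadratic form costs twice the
  bound of S times the norm sqrt 2 |phi_z(w)| of their difference.\<close>

lemma berezin_Lipschitz:
  assumes S: "bounded_op S"
  obtains K where "\<And>z. z \<in> disc \<Longrightarrow> cmod (berezin S z) \<le> K"
    and "\<And>z w. z \<in> disc \<Longrightarrow> w \<in> disc \<Longrightarrow> cmod (berezin S z - berezin S w) \<le> 2 * sqrt 2 * K * cmod (phi z w)"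
proof -
  from S obtain K0 where Sb: "\<And>f. f \<in> bergman_space \<Longrightarrow> S f \<in> bergman_space"
    and lin: "\<And>f g a b. f \<in> bergman_space \<Longrightarrow> g \<in> bergman_space \<Longrightarrow>
        S (\<lambda>w. a * f w + b * g w) = (\<lambda>w. a * S f w + b * S g w)"
    and K0: "\<And>f. f \<in> bergman_space \<Longrightarrow> berg_norm (S f) \<le> K0 * berg_norm f"
    unfolding bounded_op_def by blast
  note kb = U_op_e0_bergman_space
  have K0': "cmod (berg_inner (S f) g) \<le> K0 * berg_norm f * berg_norm g"
    if "f \<in> bergman_space" "g \<in> bergman_space" for f g
    using berg_inner_Cauchy_Schwarz[OF Sb[OF that(1)] that(2)] mult_right_mono[OF K0[OF that(1)] berg_norm_nonneg[OF that(2)]]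
    by linarith
  have bound: "cmod (berezin S z) \<le> K0" if "z \<in> disc" for z
    using K0'[OF kb[OF that] kb[OF that]] by (simp add: berezin_def berg_norm_U_op_e0[OF that])
  have lip: "cmod (berezin S z - berezin S w) \<le> 2 * sqrt 2 * K0 * cmod (phi z w)"
    if z: "z \<in> disc" and w: "w \<in> disc" for z w
  proof -
    let ?kz = "U_op z e0" and ?kw = "U_op w e0"
    \<comment> \<open>The phase of the inner product: it makes
      \<open>cnj c * berg_inner ?kz ?kw\<close> positive and so minimizes the distance from k_z to c
      k_w.\<close>
    define c where "c = sgn (berg_inner ?kz ?kw)"
    have pos: "0 < 1 - (cmod (phi z w))\<^sup>2"
      using norm_phi_less_1[OF z w] power_less_one_iff[of "cmod (phi z w)" 2] by simp
    then have nz: "berg_inner ?kz ?kw \<noteq> 0"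
      using norm_berg_inner_U_op_e0[OF z w] by auto
    have c1: "cmod c = 1" using nz by (simp add: c_def norm_sgn)
    have cc: "c * cnj c = 1" using c1 by (simp add: complex_norm_square[symmetric])
    have cI: "cnj c * berg_inner ?kz ?kw = of_real (1 - (cmod (phi z w))\<^sup>2)"
    proof -
      have "berg_inner ?kz ?kw = c * of_real (cmod (berg_inner ?kz ?kw))"
        using nz by (simp add: c_def sgn_div_norm scaleR_conv_of_real)
      then have "cnj c * berg_inner ?kz ?kw = (c * cnj c) * of_real (cmod (berg_inner ?kz ?kw))"
        by (metis mult.assoc mult.commute)
      then show ?thesis by (simp add: cc norm_berg_inner_U_op_e0[OF z w])
    qed
    \<comment> \<open>Written with explicit coefficients so that the linearity clause of
      \<open>bounded_op\<close> applies literally.\<close>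
    define d where "d = (\<lambda>u. 1 * ?kz u + (- c) * ?kw u)"
    have d: "d \<in> bergman_space" unfolding d_def by (intro bergman_space_lincomb kb z w)
    note Sz = Sb[OF kb[OF z]] and Sw = Sb[OF kb[OF w]] and Sd = Sb[OF d]
    note meas = bergman_space_measurable
    have norm_d: "berg_norm d = sqrt 2 * cmod (phi z w)"
    proof -
      have I: "berg_inner f g = (\<integral>u. f u * cnj (g u) \<partial>area)" if "f \<in> bergman_space" "g \<in> bergman_space" for f g
        using that by (intro berg_inner_area meas)
      note ii = bergman_space_integrable_mult
      have 1: "berg_inner ?kz ?kz = 1" "berg_inner ?kw ?kw = 1"
      proof -
        have "berg_inner f f = 1" if "f \<in> bergman_space" "berg_norm f = 1" for f
        proof -
          have "berg_inner f f = of_real (\<integral>u. (cmod (f u))\<^sup>2 \<partial>area)"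
            using that meas[OF that(1)] by (simp add: I complex_norm_square[symmetric] del: of_real_power)
          then show ?thesis using that by (simp add: berg_norm_area meas)
        qed
        then show "berg_inner ?kz ?kz = 1" "berg_inner ?kw ?kw = 1"
          using kb z w berg_norm_U_op_e0 by blast+
      qed
      have 2: "berg_inner ?kw ?kz = cnj (berg_inner ?kz ?kw)"
        unfolding I[OF kb[OF z] kb[OF w]] I[OF kb[OF w] kb[OF z]]
        using Bochner_Integration.integral_cnj[of area "\<lambda>u. ?kz u * cnj (?kw u)"] by (simp add: mult.commute)
      have "berg_inner d d = (\<integral>u. (?kz u * cnj (?kz u) - cnj c * (?kz u * cnj (?kw u)))
          - (c * (?kw u * cnj (?kz u)) - (c * cnj c) * (?kw u * cnj (?kw u))) \<partial>area)"
        unfolding I[OF d d] by (rule Bochner_Integration.integral_cong) (auto simp: d_def algebra_simps)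
      also have "\<dots> = (berg_inner ?kz ?kz - cnj c * berg_inner ?kz ?kw) - (c * berg_inner ?kw ?kz - (c * cnj c) * berg_inner ?kw ?kw)"
        using kb z w ii by (simp add: I)
      also have "\<dots> = 2 - (cnj c * berg_inner ?kz ?kw + cnj (cnj c * berg_inner ?kz ?kw))"
        by (simp add: 1 2 cc)
      also have "\<dots> = of_real (2 * (cmod (phi z w))\<^sup>2)" unfolding cI by simp
      finally show ?thesis by (simp add: berg_norm_def real_sqrt_mult)
    qed
    have Sd_eq: "S d = (\<lambda>u. 1 * S ?kz u + (- c) * S ?kw u)"
      unfolding d_def by (intro lin kb z w)
    have I: "berg_inner f g = (\<integral>u. f u * cnj (g u) \<partial>area)" if "f \<in> bergman_space" "g \<in> bergman_space" for f g
      using that by (intro berg_inner_area meas)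
    note ii = bergman_space_integrable_mult
    have e1: "berg_inner (S d) ?kz = berg_inner (S ?kz) ?kz - c * berg_inner (S ?kw) ?kz"
    proof -
      have "berg_inner (S d) ?kz = (\<integral>u. S ?kz u * cnj (?kz u) - c * (S ?kw u * cnj (?kz u)) \<partial>area)"
        unfolding I[OF Sd kb[OF z]] by (rule Bochner_Integration.integral_cong) (auto simp: Sd_eq algebra_simps)
      then show ?thesis using Sz Sw kb z ii by (simp add: I)
    qed
    have e2: "berg_inner (S ?kw) d = berg_inner (S ?kw) ?kz - cnj c * berg_inner (S ?kw) ?kw"
    proof -
      have "berg_inner (S ?kw) d = (\<integral>u. S ?kw u * cnj (?kz u) - cnj c * (S ?kw u * cnj (?kw u)) \<partial>area)"
        unfolding I[OF Sw d] by (rule Bochner_Integration.integral_cong) (auto simp: d_def algebra_simps)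
      then show ?thesis using Sz Sw kb z w ii by (simp add: I)
    qed
    \<comment> \<open>Telescoping: the mixed term c <S k_w, k_z> cancels, and c conj(c) = 1 restores
      the Berezin transform at w.\<close>
    have "berezin S z - berezin S w = berg_inner (S d) ?kz + c * berg_inner (S ?kw) d"
      using cc by (simp add: berezin_def e1 e2 algebra_simps)
    then have "cmod (berezin S z - berezin S w) \<le> cmod (berg_inner (S d) ?kz) + cmod (berg_inner (S ?kw) d)"
      using norm_triangle_ineq[of "berg_inner (S d) ?kz" "c * berg_inner (S ?kw) d"] by (simp add: norm_mult c1)
    also have "\<dots> \<le> K0 * berg_norm d * berg_norm ?kz + K0 * berg_norm ?kw * berg_norm d"
      by (intro add_mono K0' d kb z w)
    also have "\<dots> = 2 * sqrt 2 * K0 * cmod (phi z w)"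
      by (simp add: norm_d berg_norm_U_op_e0[OF z] berg_norm_U_op_e0[OF w])
    finally show ?thesis .
  qed
  from that[OF bound lip] show thesis .
qed

lemma berezin_in_calA:
  assumes "bounded_op S"
  shows "berezin S \<in> calA"
proof -
  obtain K where b: "\<And>z. z \<in> disc \<Longrightarrow> cmod (berezin S z) \<le> K"
    and l: "\<And>z w. z \<in> disc \<Longrightarrow> w \<in> disc \<Longrightarrow> cmod (berezin S z - berezin S w) \<le> 2 * sqrt 2 * K * cmod (phi z w)"
    using berezin_Lipschitz[OF assms] by metis
  have K: "0 \<le> K" using b[of 0] norm_ge_zero[of "berezin S 0"] by (meson centre_in_ball order_trans zero_less_one)
  have "\<exists>d>0. \<forall>z\<in>disc. \<forall>w\<in>disc. hyp_dist z w < d \<longrightarrow> cmod (berezin S z - berezin S w) < e" if e: "e > 0" for e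
  proof -
    \<comment> \<open>The added 1 keeps L positive when K = 0, so that e / L is a valid
      radius.\<close>
    define L where "L = 2 * sqrt 2 * K + 1"
    have L: "0 < L" using K by (simp add: L_def add_nonneg_pos)
    show ?thesis
    proof (intro exI[of _ "e / L"] conjI ballI impI)
      show "0 < e / L" using e L by simp
      fix z w :: complex assume zw: "z \<in> disc" "w \<in> disc" and h: "hyp_dist z w < e / L"
      have "2 * sqrt 2 * K * cmod (phi z w) \<le> L * cmod (phi z w)"
        by (intro mult_right_mono) (auto simp: L_def)
      also have "\<dots> \<le> L * hyp_dist z w"
        using L by (intro mult_left_mono hyp_dist_ge_norm_phi zw) auto
      also have "\<dots> < e" using h L by (simp add: less_divide_eq mult.commute)
      finally show "cmod (berezin S z - berezin S w) < e" using l[OF zw] by linarith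
    qed
  qed
  with b show ?thesis unfolding calA_def by blast
qed

section \<open>From almost everywhere estimates to uniform ones, and closedness of
  \<open>calA\<close>\<close>

lemma calA_continuous_on:
  assumes "b \<in> calA"
  shows "continuous_on disc b"
proof (clarsimp simp only: continuous_on_iff)
  fix z :: complex and e :: real assume z: "z \<in> disc" and e: "0 < e"
  from assms e obtain d where d: "d > 0"
    "\<And>z w. z \<in> disc \<Longrightarrow> w \<in> disc \<Longrightarrow> hyp_dist z w < d \<Longrightarrow> cmod (b z - b w) < e"
    unfolding calA_def by blast
  \<comment> \<open>The hyperbolic distance from z is Euclidean continuous at z and vanishes there,
    so small Euclidean balls lie in small hyperbolic ones.\<close>
  have "isCont (hyp_dist z) z"
  proof -
    have "1 - cnj z * z \<noteq> 0" using one_minus_cnj_mult_nonzero[OF z z] .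
    moreover have "phi z z = 0" by (simp add: phi_def)
    ultimately show ?thesis
      unfolding hyp_dist_def phi_def by (intro continuous_intros) (auto simp: phi_def)
  qed
  moreover have "hyp_dist z z = 0" by (simp add: hyp_dist_def phi_def)
  ultimately have "((\<lambda>w. hyp_dist z w) \<longlongrightarrow> 0) (at z)" by (simp add: isCont_def)
  then have "\<forall>\<^sub>F w in at z. hyp_dist z w < d" using d(1) by (rule order_tendstoD)
  then obtain r where r: "r > 0" "\<And>w. w \<noteq> z \<Longrightarrow> dist w z < r \<Longrightarrow> hyp_dist z w < d"
    unfolding eventually_at by auto
  show "\<exists>r>0. \<forall>w\<in>disc. dist w z < r \<longrightarrow> dist (b w) (b z) < e"
  proof (intro exI[of _ r] conjI ballI impI)
    fix w assume "w \<in> disc" "dist w z < r"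
    then show "dist (b w) (b z) < e"
      using r(2)[of w] d(2)[OF z, of w] e by (cases "w = z") (auto simp: dist_norm norm_minus_commute)
  qed (rule r)
qed

text \<open>For continuous f the bound defines a relatively closed subset of the disc. A closed set
  containing almost every point of an open set contains all of it.\<close>

lemma norm_le_of_AE:
  fixes f :: "complex \<Rightarrow> complex"
  assumes cont: "continuous_on disc f" and ae: "AE z in lebesgue. z \<in> disc \<longrightarrow> cmod (f z) \<le> c" and z: "z \<in> disc"
  shows "cmod (f z) \<le> c"
proof -
  obtain F where F: "closed F" "F \<inter> disc = {z \<in> disc. cmod (f z) \<le> c}"
  proof -
    have "closedin (top_of_set disc) {z \<in> disc. f z \<in> cball 0 c}"
      using cont by (intro continuous_closedin_preimage[unfolded vimage_def Int_def mem_Collect_eq]) auto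
    then show thesis using that by (auto simp: closedin_closed Int_commute)
  qed
  have "z \<in> F"
  proof (rule mem_closed_if_AE_lebesgue_open[OF open_ball F(1) _ z])
    show "AE z\<in>disc in lebesgue. z \<in> F"
      using ae by eventually_elim (use F in auto)
  qed
  then have "z \<in> {z \<in> disc. cmod (f z) \<le> c}" using z unfolding F(2)[symmetric] by blast
  then show ?thesis by blast
qed

text \<open>Approximants in \<open>calA\<close> are continuous, so being essentially close to the
  same a makes them uniformly Cauchy everywhere on the disc. Their uniform limit is the
  representative b.\<close>

lemma Linf_closure_subset:
  assumes "a \<in> Linf_closure B" "B \<subseteq> calA"
  shows "\<exists>b\<in>calA. AE z in lebesgue. z \<in> disc \<longrightarrow> a z = b z"
proof -
  define e where "e = (\<lambda>n. 1 / real (Suc n))"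
  have e0: "e \<longlonglongrightarrow> 0" unfolding e_def by (rule LIMSEQ_Suc[OF lim_1_over_n])
  have epos: "0 < e n" for n by (simp add: e_def)
  have "\<forall>n. \<exists>s\<in>B. AE z in lebesgue. z \<in> disc \<longrightarrow> cmod (a z - s z) < e n"
    using assms(1) epos by (auto simp: Linf_closure_def)
  then obtain s where sB: "\<And>n. s n \<in> B" and s: "\<And>n. AE z in lebesgue. z \<in> disc \<longrightarrow> cmod (a z - s n z) < e n"
    by metis
  have sA: "s n \<in> calA" for n using sB assms(2) by auto
  \<comment> \<open>The triangle inequality through a holds only almost everywhere; continuity of
    both approximants extends it to every point.\<close>
  have diff: "cmod (s n z - s m z) \<le> e n + e m" if "z \<in> disc" for n m z
  proof (rule norm_le_of_AE[of "\<lambda>z. s n z - s m z", OF _ _ that])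
    show "continuous_on disc (\<lambda>z. s n z - s m z)"
      by (intro continuous_intros calA_continuous_on sA)
    show "AE z in lebesgue. z \<in> disc \<longrightarrow> cmod (s n z - s m z) \<le> e n + e m"
      using s[of n] s[of m]
    proof eventually_elim
      case (elim z)
      have "cmod (s n z - s m z) \<le> cmod (a z - s n z) + cmod (a z - s m z)"
        using norm_triangle_ineq4[of "a z - s m z" "a z - s n z"] by simp
      then show ?case using elim by auto
    qed
  qed
  have conv: "convergent (\<lambda>n. s n z)" if "z \<in> disc" for z
  proof (rule Cauchy_convergent, rule CauchyI)
    fix r :: real assume "0 < r"
    then obtain N where N: "\<And>n. n \<ge> N \<Longrightarrow> e n < r / 2"
      using order_tendstoD(2)[OF e0, of "r / 2"] by (auto simp: eventually_sequentially)
    show "\<exists>M. \<forall>m\<ge>M. \<forall>n\<ge>M. norm (s m z - s n z) < r"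
    proof (intro exI[of _ N] allI impI)
      fix m n assume "N \<le> m" "N \<le> n"
      then show "norm (s m z - s n z) < r" using diff[OF that, of m n] N[of m] N[of n] by linarith
    qed
  qed
  define b where "b = (\<lambda>z. lim (\<lambda>n. s n z))"
  have lim: "(\<lambda>n. s n z) \<longlonglongrightarrow> b z" if "z \<in> disc" for z
    using conv[OF that] by (simp add: b_def convergent_LIMSEQ_iff)
  have bs: "cmod (b z - s m z) \<le> e m" if "z \<in> disc" for z m
  proof (rule tendsto_le[OF sequentially_bot])
    show "(\<lambda>n. cmod (s n z - s m z)) \<longlonglongrightarrow> cmod (b z - s m z)"
      by (intro tendsto_intros lim that)
    show "(\<lambda>n. e n + e m) \<longlonglongrightarrow> e m" using tendsto_add[OF e0 tendsto_const[of "e m"]] by simp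
    show "\<forall>\<^sub>F n in sequentially. cmod (s n z - s m z) \<le> e n + e m" using diff[OF that] by simp
  qed
  \<comment> \<open>The usual three-term argument: two uniform errors below r/3 and the modulus of
    continuity of one approximant.\<close>
  have "b \<in> calA"
  proof -
    obtain M where M: "\<And>z. z \<in> disc \<Longrightarrow> cmod (s 0 z) \<le> M"
      using sA[of 0] unfolding calA_def by blast
    have "cmod (b z) \<le> M + e 0" if "z \<in> disc" for z
      using M[OF that] bs[OF that, of 0] norm_triangle_ineq2[of "b z" "s 0 z"] by linarith
    moreover have "\<exists>d>0. \<forall>z\<in>disc. \<forall>w\<in>disc. hyp_dist z w < d \<longrightarrow> cmod (b z - b w) < r" if r: "r > 0" for r
    proof -
      have r3: "0 < r / 3" using r by simp
      obtain m where m: "e m < r / 3"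
        using eventually_happens'[OF sequentially_bot order_tendstoD(2)[OF e0 r3]] by blast
      from sA[of m] r3 obtain d where d: "d > 0"
        "\<And>z w. z \<in> disc \<Longrightarrow> w \<in> disc \<Longrightarrow> hyp_dist z w < d \<Longrightarrow> cmod (s m z - s m w) < r / 3"
        unfolding calA_def by blast
      have "cmod (b z - b w) < r" if "z \<in> disc" "w \<in> disc" "hyp_dist z w < d" for z w
      proof -
        have eq: "b z - b w = (b z - s m z) + (s m z - s m w) - (b w - s m w)" by simp
        have "cmod (b z - b w) \<le> cmod (b z - s m z) + cmod (s m z - s m w) + cmod (b w - s m w)"
          unfolding eq using norm_triangle_ineq4[of "(b z - s m z) + (s m z - s m w)" "b w - s m w"]
            norm_triangle_ineq[of "b z - s m z" "s m z - s m w"] by linarith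
        then show ?thesis using bs[OF that(1), of m] bs[OF that(2), of m] d(2)[OF that] m by linarith
      qed
      then show ?thesis using d(1) by blast
    qed
    ultimately show ?thesis unfolding calA_def by blast
  qed
  moreover have "AE z in lebesgue. z \<in> disc \<longrightarrow> a z = b z"
  proof -
    have "AE z in lebesgue. \<forall>n. z \<in> disc \<longrightarrow> cmod (a z - s n z) < e n"
      unfolding AE_all_countable using s by blast
    then show ?thesis
    proof eventually_elim
      case (elim z)
      show ?case
      proof
        assume z: "z \<in> disc"
        have "(\<lambda>n. a z - s n z) \<longlonglongrightarrow> 0"
          by (rule Lim_null_comparison[OF _ e0]) (use elim z in \<open>auto intro!: always_eventually less_imp_le\<close>)
        moreover have "(\<lambda>n. a z - s n z) \<longlonglongrightarrow> a z - b z" by (intro tendsto_intros lim z)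
        ultimately show "a z = b z" using LIMSEQ_unique by fastforce
      qed
    qed
  qed
  ultimately show ?thesis by blast
qed

section \<open>Averaged operators\<close>

lemma norm_one_minus_cnj_mult_ge:
  assumes "u \<in> disc"
  shows "1 - cmod z \<le> cmod (1 - cnj z * u)" "1 - cmod z \<le> cmod (1 - cnj u * z)"
proof -
  have le: "cmod z * cmod u \<le> cmod z" using assms by (simp add: mult_left_le)
  show "1 - cmod z \<le> cmod (1 - cnj z * u)"
    using norm_triangle_ineq2[of 1 "cnj z * u"] le by (simp add: norm_mult)
  show "1 - cmod z \<le> cmod (1 - cnj u * z)"
    using norm_triangle_ineq2[of 1 "cnj u * z"] le by (simp add: norm_mult mult.commute)
qed

lemma norm_mult_le_norm_mult:
  fixes x y :: complex
  assumes "cmod x \<le> C"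
  shows "norm (x * y) \<le> norm (C * cmod y)"
  using mult_right_mono[OF assms norm_ge_zero[of y]] abs_ge_self[of "C * cmod y"] by (simp add: norm_mult)

lemma kern_le:
  assumes "z \<in> disc" "u \<in> disc"
  shows "kern z u \<le> 1 / (1 - cmod z)\<^sup>2"
proof -
  have "(1 - cmod z)\<^sup>2 \<le> (cmod (1 - cnj u * z))\<^sup>2"
    using norm_one_minus_cnj_mult_ge(2)[OF assms(2)] assms(1) by (intro power_mono) auto
  then show ?thesis
    using assms one_minus_cnj_mult_nonzero[OF assms(2,1)]
    unfolding kern_def by (intro divide_left_mono) (auto intro!: mult_pos_pos)
qed

text \<open>\<open>area\<close> has mass 1, so Cauchy-Schwarz against the constant 1 deduces an L^1
  bound from the L^2 bound.\<close>

lemma nn_integral_Pplus_finite: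
  assumes [measurable]: "F \<in> borel_measurable borel" and F: "(\<integral>\<^sup>+x. (F x)\<^sup>2 \<partial>area) < \<infinity>"
  shows "(\<integral>\<^sup>+x. Pplus F x \<partial>area) < \<infinity>"
proof -
  have "(\<integral>\<^sup>+x. Pplus F x * 1 \<partial>area)\<^sup>2 \<le> (\<integral>\<^sup>+x. (Pplus F x)\<^sup>2 \<partial>area) * (\<integral>\<^sup>+x. 1\<^sup>2 \<partial>area)"
    by (rule Cauchy_Schwarz_nn_integral) measurable
  also have "\<dots> = (\<integral>\<^sup>+x. (Pplus F x)\<^sup>2 \<partial>area)" by simp
  also have "\<dots> \<le> ennreal (4 * pi\<^sup>2) * (\<integral>\<^sup>+x. (F x)\<^sup>2 \<partial>area)"
    by (rule Pplus_L2) measurable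
  also have "\<dots> < \<infinity>" using F by (simp add: ennreal_mult_less_top)
  finally show ?thesis by (simp add: power_less_top_ennreal)
qed

text \<open>Integral kernel of $U_\<zeta> R_n U_\<zeta>^*$, divided by $(1 - |\<zeta>|^2)^2$.\<close>
definition Qker :: "nat \<Rightarrow> complex \<Rightarrow> complex \<Rightarrow> complex \<Rightarrow> complex" where
  "Qker n x \<zeta> u = of_nat (n + 1) * of_real ((1 - (cmod \<zeta>)\<^sup>2) ^ n) * (1 - x * cnj u) ^ n
     / ((1 - cnj \<zeta> * x) ^ (n + 2) * (1 - \<zeta> * cnj u) ^ (n + 2))"

lemma measurable_Qker [measurable (raw)]:
  assumes [measurable]: "f \<in> borel_measurable M" "g \<in> borel_measurable M" "h \<in> borel_measurable M"
  shows "(\<lambda>p. Qker n (f p) (g p) (h p)) \<in> borel_measurable M"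
  unfolding Qker_def by measurable

text \<open>Regrouping n of the n+2 denominator factors with the weight turns the kernel into
  (n+1)(1 - phi(x) conj(phi(u)))^n / (A^2 B^2). The base has modulus at most 2, and what remains is
  a product of two Bergman kernels.\<close>

lemma norm_Qker_le:
  assumes x: "x \<in> disc" and z: "\<zeta> \<in> disc" and u: "u \<in> disc"
  shows "cmod (Qker n x \<zeta> u) \<le> real (n + 1) * 2 ^ n * (kern x \<zeta> * kern \<zeta> u)"
proof -
  define A where "A = 1 - cnj \<zeta> * x"
  define B where "B = 1 - \<zeta> * cnj u"
  have "Qker n x \<zeta> u = of_nat (n + 1) * (of_real (1 - (cmod \<zeta>)\<^sup>2) * (1 - x * cnj u) / (A * B)) ^ n * (1 / (A\<^sup>2 * B\<^sup>2))"
  proof -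
    have "N * W ^ n * Y ^ n / (A ^ (n + 2) * B ^ (n + 2)) = N * (W * Y / (A * B)) ^ n * (1 / (A\<^sup>2 * B\<^sup>2))"
      for N W Y :: complex
      by (simp add: power_mult_distrib power_divide power_add power2_eq_square mult_ac)
    then show ?thesis unfolding Qker_def A_def[symmetric] B_def[symmetric] of_real_power .
  qed
  also have "of_real (1 - (cmod \<zeta>)\<^sup>2) * (1 - x * cnj u) / (A * B) = 1 - phi \<zeta> x * cnj (phi \<zeta> u)"
    unfolding A_def B_def by (rule one_minus_phi_mult_cnj_phi[OF z x u, symmetric])
  finally have "cmod (Qker n x \<zeta> u) = real (n + 1) * cmod (1 - phi \<zeta> x * cnj (phi \<zeta> u)) ^ n * (1 / ((cmod A)\<^sup>2 * (cmod B)\<^sup>2))"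
    by (simp add: norm_mult norm_divide norm_power del: of_nat_Suc of_nat_add)
  also have "1 / ((cmod A)\<^sup>2 * (cmod B)\<^sup>2) = kern x \<zeta> * kern \<zeta> u"
    by (simp add: kern_def A_def B_def mult.commute)
  also have "real (n + 1) * cmod (1 - phi \<zeta> x * cnj (phi \<zeta> u)) ^ n * (kern x \<zeta> * kern \<zeta> u)
      \<le> real (n + 1) * 2 ^ n * (kern x \<zeta> * kern \<zeta> u)"
  proof (intro mult_right_mono mult_left_mono power_mono)
    have "cmod (phi \<zeta> x * cnj (phi \<zeta> u)) \<le> 1 * 1"
      unfolding norm_mult using norm_phi_less_1[OF z x] norm_phi_less_1[OF z u] by (intro mult_mono) auto
    then show "cmod (1 - phi \<zeta> x * cnj (phi \<zeta> u)) \<le> 2"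
      using norm_triangle_ineq4[of 1 "phi \<zeta> x * cnj (phi \<zeta> u)"] by simp
  qed auto
  finally show ?thesis .
qed

text \<open>The negative binomial series is integrated term by term, which represents the integral
  as a power series in x whose coefficients are moments of m. Integrability of m suffices because
  |\<zeta>| < 1.\<close>

lemma holomorphic_on_integral_negative_power:
  assumes m: "integrable area m"
  shows "(\<lambda>x. \<integral>\<zeta>. m \<zeta> / (1 - cnj \<zeta> * x) ^ (n + 2) \<partial>area) holomorphic_on disc"
    and "x \<in> disc \<Longrightarrow> integrable area (\<lambda>\<zeta>. m \<zeta> / (1 - cnj \<zeta> * x) ^ (n + 2))"
proof -
  have [measurable]: "m \<in> borel_measurable borel" using m by (auto dest: borel_measurable_integrable)
  define c where "c = (\<lambda>k. real ((k + n + 1) choose k))"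
  have main: "(\<lambda>k. of_real (c k) * (\<integral>\<zeta>. m \<zeta> * cnj \<zeta> ^ k \<partial>area) * (x - 0) ^ k) sums
      (\<integral>\<zeta>. m \<zeta> / (1 - cnj \<zeta> * x) ^ (n + 2) \<partial>area)
      \<and> integrable area (\<lambda>\<zeta>. m \<zeta> / (1 - cnj \<zeta> * x) ^ (n + 2))" if x: "x \<in> disc" for x
  proof -
    let ?f = "\<lambda>k \<zeta>. of_real (c k) * x ^ k * (m \<zeta> * cnj \<zeta> ^ k)"
    have sc: "summable (\<lambda>k. c k * cmod x ^ k)"
      unfolding c_def by (rule summable_negative_binomial) (use x in auto)
    have cnn: "0 \<le> c k" for k by (simp add: c_def)
    have le: "AE \<zeta> in area. norm (?f k \<zeta>) \<le> norm (c k * cmod x ^ k * cmod (m \<zeta>))" for k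
      using AE_area
    proof eventually_elim
      case (elim z)
      then have "cmod z ^ k \<le> 1" by (simp add: power_le_one)
      then have "c k * cmod x ^ k * cmod (m z) * cmod z ^ k \<le> c k * cmod x ^ k * cmod (m z) * 1"
        by (intro mult_left_mono) (auto simp: cnn)
      then show ?case using cnn by (simp add: norm_mult norm_power abs_mult mult.assoc)
    qed
    have im: "integrable area (\<lambda>\<zeta>. c k * cmod x ^ k * cmod (m \<zeta>))" for k
      using m by simp
    have int: "integrable area (?f k)" for k
      by (rule Bochner_Integration.integrable_bound[OF im _ le]) measurable
    have sn: "AE \<zeta> in area. summable (\<lambda>k. norm (?f k \<zeta>))"
    proof -
      have "AE \<zeta> in area. \<forall>k. norm (?f k \<zeta>) \<le> norm (c k * cmod x ^ k * cmod (m \<zeta>))"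
        unfolding AE_all_countable using le by blast
      then show ?thesis
      proof eventually_elim
        case (elim z)
        show ?case
          by (rule summable_comparison_test'[OF summable_mult2[OF sc, of "cmod (m z)"]])
             (use elim cnn in \<open>auto simp: abs_mult\<close>)
      qed
    qed
    have sI: "summable (\<lambda>k. \<integral>\<zeta>. norm (?f k \<zeta>) \<partial>area)"
    proof (rule summable_comparison_test'[OF summable_mult2[OF sc, of "\<integral>\<zeta>. cmod (m \<zeta>) \<partial>area"]])
      fix k
      have "(\<integral>\<zeta>. norm (?f k \<zeta>) \<partial>area) \<le> (\<integral>\<zeta>. norm (c k * cmod x ^ k * cmod (m \<zeta>)) \<partial>area)"
        by (rule integral_mono_AE[OF integrable_norm[OF int] integrable_norm[OF im] le])
      then show "norm (\<integral>\<zeta>. norm (?f k \<zeta>) \<partial>area) \<le> c k * cmod x ^ k * (\<integral>\<zeta>. cmod (m \<zeta>) \<partial>area)"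
        by (simp add: abs_mult cnn)
    qed
    have eq: "AE \<zeta> in area. (\<Sum>k. ?f k \<zeta>) = m \<zeta> / (1 - cnj \<zeta> * x) ^ (n + 2)"
      using AE_area
    proof eventually_elim
      case (elim z)
      have "(\<lambda>k. m z * (of_nat ((k + n + 1) choose k) * (cnj z * x) ^ k)) sums (m z * (1 / (1 - cnj z * x) ^ (n + 2)))"
        by (intro sums_mult negative_binomial_series norm_mult_cnj_less_1 elim x)
      then show ?case by (simp add: sums_iff c_def power_mult_distrib mult_ac)
    qed
    have "(\<lambda>k. \<integral>\<zeta>. ?f k \<zeta> \<partial>area) sums (\<integral>\<zeta>. (\<Sum>k. ?f k \<zeta>) \<partial>area)"
      by (rule sums_integral[OF int sn sI])
    also have "(\<integral>\<zeta>. (\<Sum>k. ?f k \<zeta>) \<partial>area) = (\<integral>\<zeta>. m \<zeta> / (1 - cnj \<zeta> * x) ^ (n + 2) \<partial>area)"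
      by (rule integral_cong_AE[OF _ _ eq]) measurable
    also have "(\<lambda>k. \<integral>\<zeta>. ?f k \<zeta> \<partial>area) = (\<lambda>k. of_real (c k) * (\<integral>\<zeta>. m \<zeta> * cnj \<zeta> ^ k \<partial>area) * (x - 0) ^ k)"
      by (rule ext, subst integral_mult_right_zero) (simp add: mult_ac)
    finally have 1: "(\<lambda>k. of_real (c k) * (\<integral>\<zeta>. m \<zeta> * cnj \<zeta> ^ k \<partial>area) * (x - 0) ^ k) sums
      (\<integral>\<zeta>. m \<zeta> / (1 - cnj \<zeta> * x) ^ (n + 2) \<partial>area)" .
    have "integrable area (\<lambda>\<zeta>. m \<zeta> / (1 - cnj \<zeta> * x) ^ (n + 2))"
      using integrable_suminf[OF int sn sI] by (subst integrable_cong_AE[OF _ _ eq, symmetric]) measurable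
    with 1 show ?thesis by blast
  qed
  show "(\<lambda>x. \<integral>\<zeta>. m \<zeta> / (1 - cnj \<zeta> * x) ^ (n + 2) \<partial>area) holomorphic_on disc"
    by (rule power_series_holomorphic[OF conjunct1[OF main]])
  show "x \<in> disc \<Longrightarrow> integrable area (\<lambda>\<zeta>. m \<zeta> / (1 - cnj \<zeta> * x) ^ (n + 2))"
    using main by blast
qed

text \<open>The integral of a(\<zeta>) U_\<zeta> R_n U_\<zeta>^* against invariant measure, applied
  to f: the invariant density is already absorbed into \<open>Qker\<close>. The value 0 off the disc
  matches the representation used by \<open>bergman_space\<close>.\<close>

definition Qop :: "nat \<Rightarrow> (complex \<Rightarrow> complex) \<Rightarrow> (complex \<Rightarrow> complex) \<Rightarrow> complex \<Rightarrow> complex" where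
  "Qop n a f x = (if x \<in> disc then \<integral>\<zeta>. a \<zeta> * (\<integral>u. Qker n x \<zeta> u * f u \<partial>area) \<partial>area else 0)"

lemma bergman_space_integrable:
  assumes f: "f \<in> bergman_space"
  shows "integrable area f"
proof (rule Bochner_Integration.integrable_bound)
  show "integrable area (\<lambda>w. 1 + (cmod (f w))\<^sup>2)" using f by (simp add: bergman_space_iff)
  have "x \<le> 1 + x\<^sup>2" if "0 \<le> x" for x :: real
    using sum_squares_bound[of x 1] that by simp
  then show "AE w in area. norm (f w) \<le> norm (1 + (cmod (f w))\<^sup>2)" by auto
  note [measurable] = bergman_space_measurable[OF f]
  show "f \<in> borel_measurable area" by measurable
qed

lemma Qker_integrable:
  assumes f: "f \<in> bergman_space" and x: "x \<in> disc" and z: "\<zeta> \<in> disc"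
  shows "integrable area (\<lambda>u. Qker n x \<zeta> u * f u)"
proof (rule Bochner_Integration.integrable_bound)
  note [measurable] = bergman_space_measurable[OF f]
  let ?C = "real (n + 1) * 2 ^ n * (kern x \<zeta> * (1 / (1 - cmod \<zeta>)\<^sup>2))"
  show "integrable area (\<lambda>u. ?C * cmod (f u))"
    using bergman_space_integrable[OF f] by simp
  show "(\<lambda>u. Qker n x \<zeta> u * f u) \<in> borel_measurable area" by measurable
  show "AE u in area. norm (Qker n x \<zeta> u * f u) \<le> norm (?C * cmod (f u))"
    using AE_area
  proof eventually_elim
    case (elim u)
    have "cmod (Qker n x \<zeta> u) \<le> real (n + 1) * 2 ^ n * (kern x \<zeta> * kern \<zeta> u)"
      by (rule norm_Qker_le[OF x z elim])
    also have "\<dots> \<le> ?C"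
      by (intro mult_left_mono kern_le z elim) auto
    finally show ?case by (rule norm_mult_le_norm_mult)
  qed
qed

lemma nn_integral_Qker_le:
  assumes [measurable]: "f \<in> borel_measurable borel" and x: "x \<in> disc" and z: "\<zeta> \<in> disc"
  shows "ennreal (cmod (\<integral>u. Qker n x \<zeta> u * f u \<partial>area))
    \<le> ennreal (real (n + 1) * 2 ^ n) * (ennreal (kern x \<zeta>) * Pplus (\<lambda>u. ennreal (cmod (f u))) \<zeta>)"
proof -
  have "ennreal (cmod (\<integral>u. Qker n x \<zeta> u * f u \<partial>area)) \<le> (\<integral>\<^sup>+u. ennreal (cmod (Qker n x \<zeta> u * f u)) \<partial>area)"
    by (rule norm_integral_le_nn_integral)
  also have "\<dots> \<le> (\<integral>\<^sup>+u. ennreal (real (n + 1) * 2 ^ n * kern x \<zeta>) * (ennreal (kern \<zeta> u) * ennreal (cmod (f u))) \<partial>area)"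
  proof (rule nn_integral_mono_AE)
    show "AE u in area. ennreal (cmod (Qker n x \<zeta> u * f u))
        \<le> ennreal (real (n + 1) * 2 ^ n * kern x \<zeta>) * (ennreal (kern \<zeta> u) * ennreal (cmod (f u)))"
      using AE_area
    proof eventually_elim
      case (elim u)
      have "cmod (Qker n x \<zeta> u * f u) \<le> real (n + 1) * 2 ^ n * (kern x \<zeta> * kern \<zeta> u) * cmod (f u)"
        unfolding norm_mult by (intro mult_right_mono norm_Qker_le x z elim) simp
      also have "\<dots> = (real (n + 1) * 2 ^ n * kern x \<zeta>) * (kern \<zeta> u * cmod (f u))" by simp
      finally have "ennreal (cmod (Qker n x \<zeta> u * f u)) \<le> ennreal ((real (n + 1) * 2 ^ n * kern x \<zeta>) * (kern \<zeta> u * cmod (f u)))"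
        by (rule ennreal_leI)
      also have "\<dots> = ennreal (real (n + 1) * 2 ^ n * kern x \<zeta>) * (ennreal (kern \<zeta> u) * ennreal (cmod (f u)))"
        by (subst ennreal_mult; simp add: ennreal_mult)
      finally show ?case .
    qed
  qed
  also have "\<dots> = ennreal (real (n + 1) * 2 ^ n * kern x \<zeta>) * Pplus (\<lambda>u. ennreal (cmod (f u))) \<zeta>"
    unfolding Pplus_def by (rule nn_integral_cmult) measurable
  also have "ennreal (real (n + 1) * 2 ^ n * kern x \<zeta>) = ennreal (real (n + 1) * 2 ^ n) * ennreal (kern x \<zeta>)"
    by (rule ennreal_mult) auto
  finally show ?thesis by (simp add: mult.assoc)
qed

text \<open>The kernel bound factors through \<zeta>, so the u-integral gives one application of
  \<open>Pplus\<close> and the \<zeta>-integral a second.\<close>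

lemma nn_integral_Qop_le:
  assumes [measurable]: "f \<in> borel_measurable borel" "a \<in> borel_measurable borel" and x: "x \<in> disc"
    and a: "\<And>\<zeta>. cmod (a \<zeta>) \<le> M"
  shows "(\<integral>\<^sup>+\<zeta>. ennreal (cmod (a \<zeta> * (\<integral>u. Qker n x \<zeta> u * f u \<partial>area))) \<partial>area)
    \<le> ennreal (M * (real (n + 1) * 2 ^ n)) * Pplus (Pplus (\<lambda>u. ennreal (cmod (f u)))) x"
proof -
  have M: "0 \<le> M" using a norm_ge_zero order_trans by blast
  let ?C = "ennreal (real (n + 1) * 2 ^ n)" and ?P = "Pplus (\<lambda>u. ennreal (cmod (f u)))"
  have "(\<integral>\<^sup>+\<zeta>. ennreal (cmod (a \<zeta> * (\<integral>u. Qker n x \<zeta> u * f u \<partial>area))) \<partial>area)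
      \<le> (\<integral>\<^sup>+\<zeta>. ennreal M * ?C * (ennreal (kern x \<zeta>) * ?P \<zeta>) \<partial>area)"
  proof (rule nn_integral_mono_AE)
    show "AE \<zeta> in area. ennreal (cmod (a \<zeta> * (\<integral>u. Qker n x \<zeta> u * f u \<partial>area)))
        \<le> ennreal M * ?C * (ennreal (kern x \<zeta>) * ?P \<zeta>)"
      using AE_area
    proof eventually_elim
      case (elim z)
      have "ennreal (cmod (a z * (\<integral>u. Qker n x z u * f u \<partial>area)))
          = ennreal (cmod (a z)) * ennreal (cmod (\<integral>u. Qker n x z u * f u \<partial>area))"
        by (simp add: norm_mult ennreal_mult)
      also have "\<dots> \<le> ennreal M * (?C * (ennreal (kern x z) * ?P z))"
        by (intro mult_mono ennreal_leI a nn_integral_Qker_le x elim) auto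
      finally show ?case by (simp add: mult.assoc)
    qed
  qed
  also have "\<dots> = ennreal M * ?C * Pplus ?P x"
    unfolding Pplus_def[of ?P] by (rule nn_integral_cmult) measurable
  also have "ennreal M * ?C = ennreal (M * (real (n + 1) * 2 ^ n))"
    by (rule ennreal_mult[symmetric]) (use M in auto)
  finally show ?thesis .
qed

text \<open>Finiteness is needed at every x, not just almost every x, because \<open>Qop\<close> is
  evaluated pointwise. For fixed x the outer kernel is bounded, and the inner \<open>Pplus\<close>
  is integrable.\<close>

lemma Pplus_Pplus_finite:
  assumes f: "f \<in> bergman_space" and x: "x \<in> disc"
  shows "Pplus (Pplus (\<lambda>u. ennreal (cmod (f u)))) x < \<infinity>"
proof -
  note [measurable] = bergman_space_measurable[OF f]
  let ?P = "Pplus (\<lambda>u. ennreal (cmod (f u)))"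
  have "Pplus ?P x \<le> (\<integral>\<^sup>+\<zeta>. ennreal (1 / (1 - cmod x)\<^sup>2) * ?P \<zeta> \<partial>area)"
    unfolding Pplus_def[of ?P]
  proof (rule nn_integral_mono_AE)
    show "AE u in area. ennreal (kern x u) * ?P u \<le> ennreal (1 / (1 - cmod x)\<^sup>2) * ?P u"
      using AE_area by eventually_elim (intro mult_right_mono ennreal_leI kern_le x; simp)
  qed
  also have "\<dots> = ennreal (1 / (1 - cmod x)\<^sup>2) * (\<integral>\<^sup>+\<zeta>. ?P \<zeta> \<partial>area)"
    by (rule nn_integral_cmult) measurable
  also have "\<dots> < \<infinity>"
    using nn_integral_Pplus_finite[of "\<lambda>u. ennreal (cmod (f u))"] nn_integral_norm_sq[OF f]
    by (simp add: ennreal_mult_less_top)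
  finally show ?thesis .
qed

lemma Qop_integrable:
  assumes f: "f \<in> bergman_space" and [measurable]: "a \<in> borel_measurable borel" and x: "x \<in> disc"
    and a: "\<And>\<zeta>. cmod (a \<zeta>) \<le> M"
  shows "integrable area (\<lambda>\<zeta>. a \<zeta> * (\<integral>u. Qker n x \<zeta> u * f u \<partial>area))"
proof (rule integrableI_bounded)
  note [measurable] = bergman_space_measurable[OF f]
  show "(\<lambda>\<zeta>. a \<zeta> * (\<integral>u. Qker n x \<zeta> u * f u \<partial>area)) \<in> borel_measurable area"
    by measurable
  have "ennreal (M * (real (n + 1) * 2 ^ n)) * Pplus (Pplus (\<lambda>u. ennreal (cmod (f u)))) x < \<infinity>"
    using Pplus_Pplus_finite[OF f x] by (simp add: ennreal_mult_less_top)
  then show "(\<integral>\<^sup>+\<zeta>. ennreal (norm (a \<zeta> * (\<integral>u. Qker n x \<zeta> u * f u \<partial>area))) \<partial>area) < \<infinity>"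
    using nn_integral_Qop_le[OF bergman_space_measurable[OF f] assms(2) x a, of n] by (rule le_less_trans[rotated])
qed

text \<open>Expanding (1 - x conj(u))^n separates x from u: the operator becomes a finite
  combination of powers of x times integrals of m_j(\<zeta>) / (1 - conj(\<zeta>) x)^(n+2), each
  holomorphic once m_j is integrable.\<close>

lemma Qop_holomorphic:
  assumes f: "f \<in> bergman_space" and [measurable]: "a \<in> borel_measurable borel"
    and a: "\<And>\<zeta>. cmod (a \<zeta>) \<le> M"
  shows "Qop n a f holomorphic_on disc"
proof -
  note [measurable] = bergman_space_measurable[OF f]
  define t where "t = (\<lambda>j \<zeta>. \<integral>u. cnj u ^ j / (1 - \<zeta> * cnj u) ^ (n + 2) * f u \<partial>area)"
  \<comment> \<open>\<open>t j\<close> is the u-integral belonging to the j-th binomial term;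
    \<open>m j\<close> adds the weight and the symbol, that is, everything independent of x.\<close>
  define m where "m = (\<lambda>j \<zeta>. a \<zeta> * (of_nat (n + 1) * of_real ((1 - (cmod \<zeta>)\<^sup>2) ^ n) * t j \<zeta>))"
  have [measurable]: "t j \<in> borel_measurable borel" for j unfolding t_def by measurable
  have [measurable]: "m j \<in> borel_measurable borel" for j unfolding m_def by measurable
  let ?P = "Pplus (\<lambda>u. ennreal (cmod (f u)))"
  have M: "0 \<le> M" using a norm_ge_zero order_trans by blast
  \<comment> \<open>Since 1 - |z|^2 <= 2 (1 - |z|) <= 2 |1 - z conj(u)|, the weight absorbs n of the
    n+2 denominator factors. Only a Bergman kernel remains, which makes \<open>m j\<close>
    integrable.\<close>
  have ker: "(1 - (cmod z)\<^sup>2) ^ n * cmod (cnj u ^ j / (1 - z * cnj u) ^ (n + 2)) \<le> 2 ^ n * kern z u"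
    if z: "z \<in> disc" and u: "u \<in> disc" for z u j
  proof -
    define B where "B = cmod (1 - z * cnj u)"
    have B: "1 - cmod z \<le> B" using norm_one_minus_cnj_mult_ge(2)[OF u, of z] by (simp add: B_def mult.commute)
    have Bp: "0 < B" using B z by auto
    have "(1 - (cmod z)\<^sup>2) = (1 + cmod z) * (1 - cmod z)" by (simp add: power2_eq_square algebra_simps)
    also have "\<dots> \<le> 2 * B" using z B by (intro mult_mono) auto
    finally have "(1 - (cmod z)\<^sup>2) ^ n \<le> (2 * B) ^ n"
      using one_minus_norm_sq_pos[OF z] by (intro power_mono) auto
    moreover have "cmod (cnj u ^ j / (1 - z * cnj u) ^ (n + 2)) \<le> 1 / B ^ (n + 2)"
      unfolding norm_divide norm_power complex_mod_cnj B_def[symmetric]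
      using u Bp by (intro divide_right_mono power_le_one) auto
    ultimately have "(1 - (cmod z)\<^sup>2) ^ n * cmod (cnj u ^ j / (1 - z * cnj u) ^ (n + 2)) \<le> (2 * B) ^ n * (1 / B ^ (n + 2))"
      using Bp by (intro mult_mono) auto
    also have "\<dots> = 2 ^ n * kern z u"
      using Bp by (simp add: kern_def B_def[symmetric] mult.commute[of "cnj u"] power_mult_distrib power_add power2_eq_square)
    finally show ?thesis .
  qed
  \<comment> \<open>For fixed z a crude bound is enough: its only use is to exchange the u-integral
    with the binomial sum.\<close>
  have it: "integrable area (\<lambda>u. cnj u ^ j / (1 - z * cnj u) ^ (n + 2) * f u)" if z: "z \<in> disc" for z j
  proof (rule Bochner_Integration.integrable_bound)
    let ?C = "2 ^ n * (1 / (1 - cmod z)\<^sup>2) / (1 - (cmod z)\<^sup>2) ^ n"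
    have pos: "0 < (1 - (cmod z)\<^sup>2) ^ n" using one_minus_norm_sq_pos[OF z] by simp
    show "integrable area (\<lambda>u. ?C * cmod (f u))"
      using bergman_space_integrable[OF f] by simp
    show "AE u in area. norm (cnj u ^ j / (1 - z * cnj u) ^ (n + 2) * f u) \<le> norm (?C * cmod (f u))"
      using AE_area
    proof eventually_elim
      case (elim u)
      have "(1 - (cmod z)\<^sup>2) ^ n * cmod (cnj u ^ j / (1 - z * cnj u) ^ (n + 2)) \<le> 2 ^ n * (1 / (1 - cmod z)\<^sup>2)"
        by (rule order_trans[OF ker[OF z elim]], rule mult_left_mono[OF kern_le[OF z elim]]) simp
      then have "cmod (cnj u ^ j / (1 - z * cnj u) ^ (n + 2)) \<le> ?C"
        using pos by (simp only: le_divide_eq mult.commute if_True)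
      then show ?case by (rule norm_mult_le_norm_mult)
    qed
  qed measurable
  have im: "integrable area (m j)" for j
  proof (rule integrableI_bounded)
    have "(\<integral>\<^sup>+\<zeta>. ennreal (norm (m j \<zeta>)) \<partial>area) \<le> (\<integral>\<^sup>+\<zeta>. ennreal (M * real (n + 1) * 2 ^ n) * ?P \<zeta> \<partial>area)"
    proof (rule nn_integral_mono_AE)
      show "AE z in area. ennreal (norm (m j z)) \<le> ennreal (M * real (n + 1) * 2 ^ n) * ?P z"
        using AE_area
      proof eventually_elim
        case (elim z)
        have pos: "0 < 1 - (cmod z)\<^sup>2" by (rule one_minus_norm_sq_pos[OF elim])
        let ?w = "(1 - (cmod z)\<^sup>2) ^ n"
        have "ennreal (?w * cmod (t j z)) = ennreal ?w * ennreal (cmod (t j z))"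
          using pos by (intro ennreal_mult) auto
        also have "\<dots> \<le> ennreal ?w * (\<integral>\<^sup>+u. ennreal (cmod (cnj u ^ j / (1 - z * cnj u) ^ (n + 2) * f u)) \<partial>area)"
          unfolding t_def by (intro mult_left_mono norm_integral_le_nn_integral) simp
        also have "\<dots> = (\<integral>\<^sup>+u. ennreal ?w * ennreal (cmod (cnj u ^ j / (1 - z * cnj u) ^ (n + 2) * f u)) \<partial>area)"
          by (rule nn_integral_cmult[symmetric]) measurable
        also have "\<dots> \<le> (\<integral>\<^sup>+u. ennreal (2 ^ n) * (ennreal (kern z u) * ennreal (cmod (f u))) \<partial>area)"
        proof (rule nn_integral_mono_AE)
          show "AE u in area. ennreal ?w * ennreal (cmod (cnj u ^ j / (1 - z * cnj u) ^ (n + 2) * f u))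
              \<le> ennreal (2 ^ n) * (ennreal (kern z u) * ennreal (cmod (f u)))"
            using AE_area
          proof eventually_elim
            case (elim u)
            have "?w * cmod (cnj u ^ j / (1 - z * cnj u) ^ (n + 2)) * cmod (f u) \<le> 2 ^ n * kern z u * cmod (f u)"
              by (intro mult_right_mono ker \<open>z \<in> disc\<close> elim) simp
            then have "ennreal (?w * (cmod (cnj u ^ j / (1 - z * cnj u) ^ (n + 2)) * cmod (f u))) \<le> ennreal (2 ^ n * (kern z u * cmod (f u)))"
              by (intro ennreal_leI) (simp only: mult.assoc)
            also have "ennreal (2 ^ n * (kern z u * cmod (f u))) = ennreal (2 ^ n) * (ennreal (kern z u) * ennreal (cmod (f u)))"
              by (subst ennreal_mult; simp add: ennreal_mult)
            also have "ennreal (?w * (cmod (cnj u ^ j / (1 - z * cnj u) ^ (n + 2)) * cmod (f u)))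
              = ennreal ?w * ennreal (cmod (cnj u ^ j / (1 - z * cnj u) ^ (n + 2) * f u))"
              unfolding norm_mult using pos by (intro ennreal_mult) auto
            finally show ?case .
          qed
        qed
        also have "\<dots> = ennreal (2 ^ n) * ?P z"
          unfolding Pplus_def by (rule nn_integral_cmult) measurable
        finally have *: "ennreal (?w * cmod (t j z)) \<le> ennreal (2 ^ n) * ?P z" .
        have "norm (m j z) = cmod (a z) * real (n + 1) * (?w * cmod (t j z))"
          using pos by (simp add: m_def norm_mult norm_power del: of_nat_Suc of_nat_add of_real_power of_real_diff)
        then have "ennreal (norm (m j z)) \<le> ennreal (M * real (n + 1) * (?w * cmod (t j z)))"
          using pos by (auto intro!: ennreal_leI mult_right_mono a)
        also have "\<dots> = ennreal (M * real (n + 1)) * ennreal (?w * cmod (t j z))"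
          using pos M by (intro ennreal_mult) auto
        also have "\<dots> \<le> ennreal (M * real (n + 1)) * (ennreal (2 ^ n) * ?P z)"
          by (intro mult_left_mono *) simp
        also have "\<dots> = ennreal (M * real (n + 1) * 2 ^ n) * ?P z"
          using M by (subst ennreal_mult[of "M * real (n + 1)"]) (auto simp: mult.assoc)
        finally show ?case .
      qed
    qed
    also have "\<dots> = ennreal (M * real (n + 1) * 2 ^ n) * (\<integral>\<^sup>+\<zeta>. ?P \<zeta> \<partial>area)"
      by (rule nn_integral_cmult) measurable
    also have "\<dots> < \<infinity>"
      using nn_integral_Pplus_finite[of "\<lambda>u. ennreal (cmod (f u))"] nn_integral_norm_sq[OF f]
      by (simp add: ennreal_mult_less_top)
    finally show "(\<integral>\<^sup>+\<zeta>. ennreal (norm (m j \<zeta>)) \<partial>area) < \<infinity>" .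
  qed measurable
  \<comment> \<open>The coefficient integrals: V j is the holomorphic function multiplying the j-th
    binomial term.\<close>
  define V where "V = (\<lambda>j x. \<integral>\<zeta>. m j \<zeta> / (1 - cnj \<zeta> * x) ^ (n + 2) \<partial>area)"
  have "(\<lambda>x. \<Sum>j\<le>n. of_nat (n choose j) * (- x) ^ j * V j x) holomorphic_on disc"
    unfolding V_def by (intro holomorphic_intros holomorphic_on_integral_negative_power(1) im)
  then show ?thesis
  proof (rule holomorphic_transform)
    fix x assume x: "x \<in> disc"
    have inner: "a z * (\<integral>u. Qker n x z u * f u \<partial>area)
        = (\<Sum>j\<le>n. of_nat (n choose j) * (- x) ^ j * (m j z / (1 - cnj z * x) ^ (n + 2)))" if z: "z \<in> disc" for z
    proof -
      let ?K = "of_nat (n + 1) * of_real ((1 - (cmod z)\<^sup>2) ^ n) / (1 - cnj z * x) ^ (n + 2) :: complex"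
      have "Qker n x z u * f u = (\<Sum>j\<le>n. ?K * (of_nat (n choose j) * (- x) ^ j) * (cnj u ^ j / (1 - z * cnj u) ^ (n + 2) * f u))" for u
      proof -
        have "(1 - x * cnj u) ^ n = (\<Sum>j\<le>n. of_nat (n choose j) * (- x) ^ j * cnj u ^ j)"
          using binomial_ring[of "- x * cnj u" 1 n] by (simp add: power_mult_distrib[symmetric] mult.assoc)
        then have "Qker n x z u * f u = ?K * (\<Sum>j\<le>n. of_nat (n choose j) * (- x) ^ j * cnj u ^ j) / (1 - z * cnj u) ^ (n + 2) * f u"
          by (simp only: Qker_def) simp
        then show ?thesis by (simp only: sum_distrib_left sum_distrib_right sum_divide_distrib) (simp add: mult_ac)
      qed
      then have "(\<integral>u. Qker n x z u * f u \<partial>area)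
          = (\<Sum>j\<le>n. ?K * (of_nat (n choose j) * (- x) ^ j) * t j z)"
        unfolding t_def using it[OF z] by (simp only: Bochner_Integration.integral_sum integrable_mult_right integral_mult_right_zero)
      then show ?thesis by (simp only: m_def sum_distrib_left) (simp add: mult_ac)
    qed
    have "Qop n a f x = (\<integral>\<zeta>. a \<zeta> * (\<integral>u. Qker n x \<zeta> u * f u \<partial>area) \<partial>area)"
      using x by (simp add: Qop_def)
    also have "\<dots> = (\<integral>\<zeta>. (\<Sum>j\<le>n. of_nat (n choose j) * (- x) ^ j * (m j \<zeta> / (1 - cnj \<zeta> * x) ^ (n + 2))) \<partial>area)"
    proof (rule integral_cong_AE)
      show "AE \<zeta> in area. a \<zeta> * (\<integral>u. Qker n x \<zeta> u * f u \<partial>area) =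
          (\<Sum>j\<le>n. of_nat (n choose j) * (- x) ^ j * (m j \<zeta> / (1 - cnj \<zeta> * x) ^ (n + 2)))"
        using AE_area inner by (auto elim: eventually_mono)
    qed measurable
    also have "\<dots> = (\<Sum>j\<le>n. of_nat (n choose j) * (- x) ^ j * V j x)"
      unfolding V_def using holomorphic_on_integral_negative_power(2)[OF im x]
      by (simp only: Bochner_Integration.integral_sum integrable_mult_right integral_mult_right_zero)
    finally show "(\<Sum>j\<le>n. of_nat (n choose j) * (- x) ^ j * V j x) = Qop n a f x" by simp
  qed
qed

text \<open>Domination by the square of the positive Bergman operator gives the factor 4 pi^2 = (2
  pi)^2; M (n+1) 2^n comes from the symbol and the kernel.\<close>

lemma Qop_bounded:
  assumes f: "f \<in> bergman_space" and [measurable]: "a \<in> borel_measurable borel"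
    and a: "\<And>\<zeta>. cmod (a \<zeta>) \<le> M"
  shows "Qop n a f \<in> bergman_space"
    and "berg_norm (Qop n a f) \<le> M * (real (n + 1) * 2 ^ n) * (4 * pi\<^sup>2) * berg_norm f"
proof -
  note [measurable] = bergman_space_measurable[OF f]
  have M: "0 \<le> M" using a norm_ge_zero order_trans by blast
  let ?F = "\<lambda>u. ennreal (cmod (f u))"
  let ?C = "M * (real (n + 1) * 2 ^ n)"
  have C: "0 \<le> ?C" using M by simp
  have [measurable]: "Qop n a f \<in> borel_measurable borel"
    unfolding Qop_def by (rule measurable_If) auto
  have pt: "ennreal (cmod (Qop n a f x)) \<le> ennreal ?C * Pplus (Pplus ?F) x" if x: "x \<in> disc" for x
    using norm_integral_le_nn_integral[of area "\<lambda>\<zeta>. a \<zeta> * (\<integral>u. Qker n x \<zeta> u * f u \<partial>area)"]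
      nn_integral_Qop_le[OF bergman_space_measurable[OF f] assms(2) x a, of n] x
    unfolding Qop_def by (simp only: if_True)
  have "(\<integral>\<^sup>+x. (ennreal (cmod (Qop n a f x)))\<^sup>2 \<partial>area) \<le> (\<integral>\<^sup>+x. (ennreal ?C)\<^sup>2 * (Pplus (Pplus ?F) x)\<^sup>2 \<partial>area)"
    unfolding power_mult_distrib[symmetric]
  proof (rule nn_integral_mono_AE)
    show "AE x in area. (ennreal (cmod (Qop n a f x)))\<^sup>2 \<le> (ennreal ?C * Pplus (Pplus ?F) x)\<^sup>2"
      using AE_area by eventually_elim (intro power_mono pt; simp)
  qed
  also have "\<dots> = (ennreal ?C)\<^sup>2 * (\<integral>\<^sup>+x. (Pplus (Pplus ?F) x)\<^sup>2 \<partial>area)"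
    by (rule nn_integral_cmult) measurable
  \<comment> \<open>The Schur bound is applied twice, once for each \<open>Pplus\<close>.\<close>
  also have "\<dots> \<le> (ennreal ?C)\<^sup>2 * (ennreal (4 * pi\<^sup>2) * (ennreal (4 * pi\<^sup>2) * (\<integral>\<^sup>+x. (?F x)\<^sup>2 \<partial>area)))"
    by (intro mult_left_mono order_trans[OF Pplus_L2] Pplus_L2) measurable
  also have "\<dots> = ennreal ((?C * (4 * pi\<^sup>2) * berg_norm f)\<^sup>2)"
  proof -
    have "ennreal ((?C * (4 * pi\<^sup>2) * berg_norm f)\<^sup>2) = ennreal (?C\<^sup>2 * ((4 * pi\<^sup>2) * ((4 * pi\<^sup>2) * (berg_norm f)\<^sup>2)))"
      by (simp add: power2_eq_square mult_ac)
    also have "\<dots> = ennreal (?C\<^sup>2) * (ennreal (4 * pi\<^sup>2) * (ennreal (4 * pi\<^sup>2) * ennreal ((berg_norm f)\<^sup>2)))"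
      by (simp only: ennreal_mult' zero_le_power2 mult_nonneg_nonneg zero_le_numeral)
    finally show ?thesis
      unfolding nn_integral_norm_sq[OF f] ennreal_power[OF C] by simp
  qed
  finally have main: "(\<integral>\<^sup>+x. (ennreal (cmod (Qop n a f x)))\<^sup>2 \<partial>area) \<le> ennreal ((?C * (4 * pi\<^sup>2) * berg_norm f)\<^sup>2)" .
  have "integrable area (\<lambda>x. (cmod (Qop n a f x))\<^sup>2)"
  proof (rule integrableI_bounded)
    show "(\<integral>\<^sup>+x. ennreal (norm ((cmod (Qop n a f x))\<^sup>2)) \<partial>area) < \<infinity>"
      using le_less_trans[OF main] by (simp add: ennreal_power)
  qed measurable
  then show Qb: "Qop n a f \<in> bergman_space"
    using Qop_holomorphic[OF f assms(2) a] by (simp add: bergman_space_iff) (simp add: Qop_def)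
  have "(berg_norm (Qop n a f))\<^sup>2 \<le> (?C * (4 * pi\<^sup>2) * berg_norm f)\<^sup>2"
    using main unfolding nn_integral_norm_sq[OF Qb] by (subst (asm) ennreal_le_iff) auto
  then show "berg_norm (Qop n a f) \<le> ?C * (4 * pi\<^sup>2) * berg_norm f"
    by (rule power2_le_imp_le) (use C f in simp)
qed

lemma Qop_bounded_op:
  assumes [measurable]: "a \<in> borel_measurable borel" and a: "\<And>\<zeta>. cmod (a \<zeta>) \<le> M"
  shows "bounded_op (Qop n a)"
proof -
  have "Qop n a (\<lambda>w. c * f w + d * g w) = (\<lambda>w. c * Qop n a f w + d * Qop n a g w)"
    if f: "f \<in> bergman_space" and g: "g \<in> bergman_space" for f g c d
  proof
    fix x
    note [measurable] = bergman_space_measurable[OF f] bergman_space_measurable[OF g]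
    show "Qop n a (\<lambda>w. c * f w + d * g w) x = c * Qop n a f x + d * Qop n a g x"
    proof (cases "x \<in> disc")
      case x: True
      have "(\<integral>\<zeta>. a \<zeta> * (\<integral>u. Qker n x \<zeta> u * (c * f u + d * g u) \<partial>area) \<partial>area)
        = (\<integral>\<zeta>. c * (a \<zeta> * (\<integral>u. Qker n x \<zeta> u * f u \<partial>area)) + d * (a \<zeta> * (\<integral>u. Qker n x \<zeta> u * g u \<partial>area)) \<partial>area)"
      proof (rule integral_cong_AE)
        show "AE \<zeta> in area. a \<zeta> * (\<integral>u. Qker n x \<zeta> u * (c * f u + d * g u) \<partial>area)
          = c * (a \<zeta> * (\<integral>u. Qker n x \<zeta> u * f u \<partial>area)) + d * (a \<zeta> * (\<integral>u. Qker n x \<zeta> u * g u \<partial>area))"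
          using AE_area
        proof eventually_elim
          case (elim z)
          have "(\<integral>u. Qker n x z u * (c * f u + d * g u) \<partial>area)
            = (\<integral>u. c * (Qker n x z u * f u) + d * (Qker n x z u * g u) \<partial>area)"
            by (simp add: algebra_simps)
          also have "\<dots> = c * (\<integral>u. Qker n x z u * f u \<partial>area) + d * (\<integral>u. Qker n x z u * g u \<partial>area)"
            using Qker_integrable[OF f x elim] Qker_integrable[OF g x elim] by simp
          finally show ?case by (simp add: algebra_simps)
        qed
      qed measurable
      also have "\<dots> = c * (\<integral>\<zeta>. a \<zeta> * (\<integral>u. Qker n x \<zeta> u * f u \<partial>area) \<partial>area) + d * (\<integral>\<zeta>. a \<zeta> * (\<integral>u. Qker n x \<zeta> u * g u \<partial>area) \<partial>area)"
        using Qop_integrable[OF f assms(1) x a] Qop_integrable[OF g assms(1) x a] by simp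
      finally show ?thesis using x by (simp add: Qop_def)
    qed (simp add: Qop_def)
  qed
  then show ?thesis
    unfolding bounded_op_def using Qop_bounded[OF _ assms(1) a] by blast
qed

section \<open>Approximation by Berezin transforms\<close>

text \<open>The last factor is |k_z(\<zeta>)|^2; the power is largest where phi_z(\<zeta>) = 0, that
  is at \<zeta> = z, and n+1 normalizes the mass.\<close>

definition Bker :: "nat \<Rightarrow> complex \<Rightarrow> complex \<Rightarrow> real" where
  "Bker n z \<zeta> = real (n + 1) * (1 - (cmod (phi z \<zeta>))\<^sup>2) ^ n * ((1 - (cmod z)\<^sup>2)\<^sup>2 * (kern z \<zeta>)\<^sup>2)"

lemma measurable_Bker [measurable]: "Bker n z \<in> borel_measurable borel"
  unfolding Bker_def phi_def by measurable

lemma Bker_nonneg: "z \<in> disc \<Longrightarrow> \<zeta> \<in> disc \<Longrightarrow> 0 \<le> Bker n z \<zeta>"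
  using norm_phi_less_1[of z \<zeta>] by (auto simp: Bker_def power_le_one intro!: mult_nonneg_nonneg)

text \<open>Separates the factors depending on z and \<zeta>: up to a constant in \<zeta> this is
  the weight (1 - |\<zeta>|^2)^n times the squared modulus of its reproducing kernel.\<close>

lemma Bker_altdef:
  assumes z: "z \<in> disc" and x: "\<zeta> \<in> disc"
  shows "Bker n z \<zeta> = real (n + 1) * ((1 - (cmod z)\<^sup>2) ^ (n + 2) * (1 - (cmod \<zeta>)\<^sup>2) ^ n / (cmod (1 - cnj z * \<zeta>)) ^ (2 * (n + 2)))"
proof -
  have "N * (W * Y / B\<^sup>2) ^ n * (W\<^sup>2 * (1 / B\<^sup>2)\<^sup>2) = N * (W ^ (n + 2) * Y ^ n / B ^ (2 * (n + 2)))"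
    for N W Y B :: real
    by (simp add: power_mult_distrib power_divide power_add power_mult power2_eq_square mult_ac)
  then show ?thesis
    unfolding Bker_def one_minus_norm_phi_sq[OF z x] kern_commute[of z] unfolding kern_def .
qed

text \<open>Apply the weighted reproducing formula to the kernel function h centred at z itself: the
  squared weighted norm of h is its value h(z) divided by n+1.\<close>

lemma Bker_integral:
  assumes z: "z \<in> disc"
  shows "integrable area (Bker n z)" "(\<integral>\<zeta>. Bker n z \<zeta> \<partial>area) = 1"
proof -
  let ?d = "1 - (cmod z)\<^sup>2"
  have d: "0 < ?d" by (rule one_minus_norm_sq_pos[OF z])
  show int: "integrable area (Bker n z)"
  proof (rule norm_le_integrable_area)
    fix u assume u: "u \<in> disc"
    have p: "0 \<le> 1 - (cmod (phi z u))\<^sup>2" using norm_phi_less_1[OF z u] by (simp add: power_le_one)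
    then have "(1 - (cmod (phi z u))\<^sup>2) ^ n \<le> 1" by (intro power_le_one) auto
    moreover have "?d\<^sup>2 * (kern z u)\<^sup>2 \<le> ?d\<^sup>2 * (1 / (1 - cmod z)\<^sup>2)\<^sup>2"
      by (intro mult_left_mono power_mono kern_le z u) auto
    ultimately have "Bker n z u \<le> real (n + 1) * 1 * (?d\<^sup>2 * (1 / (1 - cmod z)\<^sup>2)\<^sup>2)"
      unfolding Bker_def using p by (intro mult_mono[OF mult_left_mono]) auto
    then show "norm (Bker n z u) \<le> real (n + 1) * 1 * (?d\<^sup>2 * (1 / (1 - cmod z)\<^sup>2)\<^sup>2)"
      using Bker_nonneg[OF z u] by simp
  qed measurable
  define h where "h = (\<lambda>u. 1 / (1 - cnj z * u) ^ (n + 2))"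
  obtain R where R: "1 < R" "\<And>u. u \<in> ball 0 R \<Longrightarrow> 1 - cnj z * u \<noteq> 0"
    using one_minus_cnj_mult_nonzero_ball[OF z] by blast
  have "h holomorphic_on ball 0 R" unfolding h_def using R(2) by (intro holomorphic_intros) auto
  moreover have [measurable]: "h \<in> borel_measurable borel" unfolding h_def by measurable
  ultimately have rep: "(\<integral>u. of_real ((1 - (cmod u)\<^sup>2) ^ n) * h u * cnj (1 / (1 - cnj z * u) ^ (n + 2)) \<partial>area) = h z / of_nat (n + 1)"
    using R(1) by (intro weighted_reproducing z)
  have zz: "1 - cnj z * z = of_real ?d" by (simp only: of_real_diff of_real_1 complex_norm_square mult.commute)
  have hz: "h z = of_real (1 / ?d ^ (n + 2))" unfolding h_def zz by simp
  have "of_real (\<integral>u. Bker n z u \<partial>area) = (\<integral>u. complex_of_real (Bker n z u) \<partial>area)" by simp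
  also have "\<dots> = (\<integral>u. of_real (real (n + 1) * ?d ^ (n + 2)) * (of_real ((1 - (cmod u)\<^sup>2) ^ n) * h u * cnj (1 / (1 - cnj z * u) ^ (n + 2))) \<partial>area)"
  proof (rule integral_cong_AE)
    show "AE u in area. complex_of_real (Bker n z u) =
      of_real (real (n + 1) * ?d ^ (n + 2)) * (of_real ((1 - (cmod u)\<^sup>2) ^ n) * h u * cnj (1 / (1 - cnj z * u) ^ (n + 2)))"
      using AE_area
    proof eventually_elim
      case (elim u)
      have "h u * cnj (h u) = of_real ((cmod (h u))\<^sup>2)" by (simp only: complex_norm_square)
      also have "(cmod (h u))\<^sup>2 = 1 / (cmod (1 - cnj z * u)) ^ (2 * (n + 2))"
        unfolding h_def norm_divide norm_power norm_one
        by (simp only: power_divide power_one power_mult[symmetric] mult.commute[of "n + 2" 2])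
      finally have "h u * cnj (h u) = of_real (1 / (cmod (1 - cnj z * u)) ^ (2 * (n + 2)))" .
      then have "of_real (real (n + 1) * ?d ^ (n + 2)) * (of_real ((1 - (cmod u)\<^sup>2) ^ n) * h u * cnj (h u))
        = complex_of_real (real (n + 1) * ?d ^ (n + 2) * ((1 - (cmod u)\<^sup>2) ^ n * (1 / (cmod (1 - cnj z * u)) ^ (2 * (n + 2)))))"
        by (simp only: of_real_mult mult.assoc)
      also have "real (n + 1) * ?d ^ (n + 2) * ((1 - (cmod u)\<^sup>2) ^ n * (1 / (cmod (1 - cnj z * u)) ^ (2 * (n + 2)))) = Bker n z u"
        by (simp only: Bker_altdef[OF z elim] mult.assoc times_divide_eq_right mult_1_right)
      finally show ?case by (simp only: h_def)
    qed
  qed measurable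
  also have "\<dots> = of_real (real (n + 1) * ?d ^ (n + 2)) * (h z / of_nat (n + 1))"
    by (simp only: integral_mult_right_zero rep)
  also have "\<dots> = of_real (real (n + 1) * ?d ^ (n + 2) * (1 / ?d ^ (n + 2) / real (n + 1)))"
    by (simp only: hz of_real_mult of_real_divide of_real_of_nat_eq)
  also have "real (n + 1) * ?d ^ (n + 2) * (1 / ?d ^ (n + 2) / real (n + 1)) = 1"
    using d by simp
  finally show "(\<integral>\<zeta>. Bker n z \<zeta> \<partial>area) = 1" by (simp only: of_real_eq_iff)
qed

text \<open>On the diagonal the two denominators are conjugate, so their product is a power of a
  modulus. The factor (1 - |z|^2)^2 comes from the two normalized kernels in the Berezin
  transform.\<close>

lemma Qker_diagonal:
  assumes z: "z \<in> disc" and x: "\<zeta> \<in> disc"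
  shows "of_real ((1 - (cmod z)\<^sup>2)\<^sup>2) * Qker n z \<zeta> z = of_real (Bker n z \<zeta>)"
proof -
  define A where "A = 1 - cnj z * \<zeta>"
  have zz: "1 - z * cnj z = of_real (1 - (cmod z)\<^sup>2)" by (simp only: of_real_diff of_real_1 complex_norm_square)
  have A: "1 - cnj \<zeta> * z = cnj A" "1 - \<zeta> * cnj z = A" by (simp_all add: A_def mult.commute)
  have "cnj A ^ (n + 2) * A ^ (n + 2) = (A * cnj A) ^ (n + 2)" by (simp only: power_mult_distrib mult.commute)
  also have "\<dots> = of_real (cmod A ^ (2 * (n + 2)))" by (simp only: complex_norm_square[symmetric] power_mult of_real_power)
  finally have "Qker n z \<zeta> z = of_real (real (n + 1) * (1 - (cmod \<zeta>)\<^sup>2) ^ n * (1 - (cmod z)\<^sup>2) ^ n / cmod A ^ (2 * (n + 2)))"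
    unfolding Qker_def zz A by (simp only: of_real_mult of_real_divide of_real_power of_real_of_nat_eq)
  then have "of_real ((1 - (cmod z)\<^sup>2)\<^sup>2) * Qker n z \<zeta> z = of_real ((1 - (cmod z)\<^sup>2)\<^sup>2 * (real (n + 1) * (1 - (cmod \<zeta>)\<^sup>2) ^ n * (1 - (cmod z)\<^sup>2) ^ n / cmod A ^ (2 * (n + 2))))"
    by (simp only: of_real_mult)
  also have "(1 - (cmod z)\<^sup>2)\<^sup>2 * (real (n + 1) * (1 - (cmod \<zeta>)\<^sup>2) ^ n * (1 - (cmod z)\<^sup>2) ^ n / cmod A ^ (2 * (n + 2))) = Bker n z \<zeta>"
    unfolding Bker_altdef[OF z x] A_def[symmetric] by (simp only: power_add times_divide_eq_right mult_ac)
  finally show ?thesis .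
qed

text \<open>In its first variable the kernel is a polynomial over (1 - conj(\<zeta>) v)^(n+2), hence
  holomorphic beyond the closed disc.\<close>

lemma Qker_reproducing_left:
  assumes z: "z \<in> disc" and x: "\<zeta> \<in> disc"
  shows "(\<integral>v. Qker n v \<zeta> u * cnj (U_op z e0 v) \<partial>area) = - of_real (1 - (cmod z)\<^sup>2) * Qker n z \<zeta> u"
proof -
  obtain R where R: "1 < R" "\<And>u. u \<in> ball 0 R \<Longrightarrow> 1 - cnj \<zeta> * u \<noteq> 0"
    using one_minus_cnj_mult_nonzero_ball[OF x] by blast
  \<comment> \<open>All factors free of v. If 1 - \<zeta> conj(u) vanishes, division by zero makes
    both C and \<open>Qker\<close> equal to 0, so u may be arbitrary.\<close>
  define C where "C = of_nat (n + 1) * of_real ((1 - (cmod \<zeta>)\<^sup>2) ^ n) / (1 - \<zeta> * cnj u) ^ (n + 2)"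
  have "Qker n v \<zeta> u = C * ((1 - v * cnj u) ^ n / (1 - cnj \<zeta> * v) ^ (n + 2))" for v
    by (simp add: Qker_def C_def)
  moreover have "(\<lambda>v. C * ((1 - v * cnj u) ^ n / (1 - cnj \<zeta> * v) ^ (n + 2))) holomorphic_on ball 0 R"
    using R(2) by (intro holomorphic_intros) auto
  ultimately have "(\<lambda>v. Qker n v \<zeta> u) holomorphic_on ball 0 R" by simp
  then show ?thesis
    using R(1) z by (intro reproducing_U_op_e0) measurable
qed

lemma Qker_commute: "Qker n x \<zeta> u = cnj (Qker n u \<zeta> x)"
  by (simp add: Qker_def mult_ac)

text \<open>Hermitian symmetry of the kernel reduces this to the first variable.\<close>

lemma Qker_reproducing_right:
  assumes z: "z \<in> disc" and x: "\<zeta> \<in> disc"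
  shows "(\<integral>u. Qker n v \<zeta> u * U_op z e0 u \<partial>area) = - of_real (1 - (cmod z)\<^sup>2) * Qker n v \<zeta> z"
proof -
  have "(\<integral>u. Qker n v \<zeta> u * U_op z e0 u \<partial>area) = (\<integral>u. cnj (Qker n u \<zeta> v * cnj (U_op z e0 u)) \<partial>area)"
    by (subst Qker_commute) simp
  also have "\<dots> = cnj (- of_real (1 - (cmod z)\<^sup>2) * Qker n z \<zeta> v)"
    by (subst Bochner_Integration.integral_cnj) (simp only: Qker_reproducing_left[OF z x])
  also have "\<dots> = - of_real (1 - (cmod z)\<^sup>2) * Qker n v \<zeta> z"
    by (subst Qker_commute[of n v]) simp
  finally show ?thesis .
qed

text \<open>Reproduction in u, exchange of the x- and \<zeta>-integrals, then reproduction in x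
  evaluate the kernel at (z, z). The two minus signs cancel and the diagonal value is
  \<open>Bker\<close>.\<close>

lemma berezin_Qop:
  assumes [measurable]: "a \<in> borel_measurable borel" and a: "\<And>\<zeta>. cmod (a \<zeta>) \<le> M" and z: "z \<in> disc"
  shows "berezin (Qop n a) z = (\<integral>\<zeta>. a \<zeta> * of_real (Bker n z \<zeta>) \<partial>area)"
proof -
  let ?k = "U_op z e0" and ?d = "complex_of_real (1 - (cmod z)\<^sup>2)"
  note kb = U_op_e0_bergman_space[OF z]
  note [measurable] = bergman_space_measurable[OF kb] bergman_space_measurable[OF Qop_bounded(1)[OF kb assms(1) a]]
  have M: "0 \<le> M" using a norm_ge_zero order_trans by blast
  have Q: "Qop n a ?k x = - ?d * (\<integral>\<zeta>. a \<zeta> * Qker n x \<zeta> z \<partial>area)" if x: "x \<in> disc" for x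
  proof -
    have "Qop n a ?k x = (\<integral>\<zeta>. - ?d * (a \<zeta> * Qker n x \<zeta> z) \<partial>area)"
      unfolding Qop_def using x
      by (simp only: if_True, intro integral_cong_AE)
         (measurable, use AE_area in \<open>auto elim!: eventually_mono simp: Qker_reproducing_right[OF z] simp del: of_real_diff of_real_power\<close>)
    then show ?thesis by (simp only: integral_mult_right_zero)
  qed
  let ?G = "\<lambda>x \<zeta>. a \<zeta> * Qker n x \<zeta> z * cnj (?k x)"
  have int: "integrable (area \<Otimes>\<^sub>M area) (\<lambda>(x, \<zeta>). ?G x \<zeta>)"
  proof (rule integrableI_bounded)
    \<comment> \<open>One factor 1/(1 - |z|)^2 bounds \<open>kern\<close> at \<zeta> and z, the
      other the normalized kernel at x. What is left is \<open>kern x \<zeta>\<close>, whose double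
      integral is that of \<open>Pplus\<close> of the constant 1.\<close>
    let ?C = "M * (real (n + 1) * 2 ^ n) * (1 / (1 - cmod z)\<^sup>2) * (1 / (1 - cmod z)\<^sup>2)"
    have "(\<integral>\<^sup>+p. ennreal (norm (case p of (x, \<zeta>) \<Rightarrow> ?G x \<zeta>)) \<partial>(area \<Otimes>\<^sub>M area))
        = (\<integral>\<^sup>+x. \<integral>\<^sup>+\<zeta>. ennreal (norm (?G x \<zeta>)) \<partial>area \<partial>area)"
    proof -
      have "(\<lambda>p. ennreal (norm (?G (fst p) (snd p)))) \<in> borel_measurable (area \<Otimes>\<^sub>M area)" by measurable
      from area.nn_integral_fst[OF this] show ?thesis by (simp only: fst_conv snd_conv case_prod_beta)
    qed
    also have "\<dots> \<le> (\<integral>\<^sup>+x. \<integral>\<^sup>+\<zeta>. ennreal ?C * (ennreal (kern x \<zeta>) * 1) \<partial>area \<partial>area)"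
    proof (rule nn_integral_mono_AE)
      show "AE x in area. (\<integral>\<^sup>+\<zeta>. ennreal (norm (?G x \<zeta>)) \<partial>area) \<le> (\<integral>\<^sup>+\<zeta>. ennreal ?C * (ennreal (kern x \<zeta>) * 1) \<partial>area)"
        using AE_area
      proof eventually_elim
        case (elim x)
        show ?case
        proof (rule nn_integral_mono_AE)
          show "AE \<zeta> in area. ennreal (norm (?G x \<zeta>)) \<le> ennreal ?C * (ennreal (kern x \<zeta>) * 1)"
            using AE_area
          proof eventually_elim
            case (elim w)
            have "cmod (Qker n x w z) \<le> real (n + 1) * 2 ^ n * (kern x w * kern w z)"
              by (rule norm_Qker_le[OF \<open>x \<in> disc\<close> elim z])
            also have "\<dots> \<le> real (n + 1) * 2 ^ n * (kern x w * (1 / (1 - cmod z)\<^sup>2))"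
              unfolding kern_commute[of w z] by (intro mult_left_mono kern_le z elim) auto
            finally have 1: "cmod (Qker n x w z) \<le> real (n + 1) * 2 ^ n * (kern x w * (1 / (1 - cmod z)\<^sup>2))" .
            have 2: "cmod (?k x) \<le> 1 / (1 - cmod z)\<^sup>2"
            proof -
              have "cmod (?k x) = (1 - (cmod z)\<^sup>2) * kern z x"
                using one_minus_norm_sq_pos[OF z] \<open>x \<in> disc\<close> unfolding kern_commute[of z x]
                by (simp add: U_op_e0[OF z] kern_def norm_divide norm_power del: of_real_diff of_real_power)
              also have "\<dots> \<le> 1 * (1 / (1 - cmod z)\<^sup>2)"
                using \<open>x \<in> disc\<close> by (intro mult_mono kern_le z) auto
              finally show ?thesis by simp
            qed
            have "norm (?G x w) \<le> M * (real (n + 1) * 2 ^ n * (kern x w * (1 / (1 - cmod z)\<^sup>2))) * (1 / (1 - cmod z)\<^sup>2)"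
              unfolding norm_mult complex_mod_cnj using M
              by (intro mult_mono a 1 2 mult_nonneg_nonneg) auto
            also have "\<dots> = ?C * kern x w" by (simp only: mult_ac)
            finally have "ennreal (norm (?G x w)) \<le> ennreal (?C * kern x w)" by (rule ennreal_leI)
            also have "\<dots> = ennreal ?C * (ennreal (kern x w) * 1)"
              using M by (simp only: mult_1_right) (rule ennreal_mult; simp)
            finally show ?case .
          qed
        qed
      qed
    qed
    also have "\<dots> = (\<integral>\<^sup>+x. ennreal ?C * Pplus (\<lambda>_. 1) x \<partial>area)"
      unfolding Pplus_def by (intro nn_integral_cong nn_integral_cmult) measurable
    also have "\<dots> = ennreal ?C * (\<integral>\<^sup>+x. Pplus (\<lambda>_. 1) x \<partial>area)"
      by (rule nn_integral_cmult) measurable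
    also have "\<dots> < \<infinity>"
      using nn_integral_Pplus_finite[of "\<lambda>_. 1"] by (simp add: ennreal_mult_less_top)
    finally show "(\<integral>\<^sup>+p. ennreal (norm (case p of (x, \<zeta>) \<Rightarrow> ?G x \<zeta>)) \<partial>(area \<Otimes>\<^sub>M area)) < \<infinity>" .
  qed measurable
  have "berezin (Qop n a) z = (\<integral>x. Qop n a ?k x * cnj (?k x) \<partial>area)"
    unfolding berezin_def by (rule berg_inner_area) measurable
  also have "\<dots> = (\<integral>x. - ?d * (\<integral>\<zeta>. ?G x \<zeta> \<partial>area) \<partial>area)"
  proof (rule integral_cong_AE)
    show "AE x in area. Qop n a ?k x * cnj (?k x) = - ?d * (\<integral>\<zeta>. ?G x \<zeta> \<partial>area)"
      using AE_area by eventually_elim (subst integral_mult_left_zero, simp only: Q mult.assoc)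
  qed measurable
  also have "\<dots> = - ?d * (\<integral>x. (\<integral>\<zeta>. ?G x \<zeta> \<partial>area) \<partial>area)"
    by (rule integral_mult_right_zero)
  also have "(\<integral>x. (\<integral>\<zeta>. ?G x \<zeta> \<partial>area) \<partial>area) = (\<integral>\<zeta>. (\<integral>x. ?G x \<zeta> \<partial>area) \<partial>area)"
    using area_pair.Fubini_integral[OF int] by simp
  also have "- ?d * \<dots> = (\<integral>\<zeta>. - ?d * (\<integral>x. ?G x \<zeta> \<partial>area) \<partial>area)"
    by (rule integral_mult_right_zero[symmetric])
  also have "\<dots> = (\<integral>\<zeta>. a \<zeta> * of_real (Bker n z \<zeta>) \<partial>area)"
  proof (rule integral_cong_AE)
    show "AE \<zeta> in area. - ?d * (\<integral>x. ?G x \<zeta> \<partial>area) = a \<zeta> * of_real (Bker n z \<zeta>)"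
      using AE_area
    proof eventually_elim
      case (elim w)
      have "(\<integral>x. ?G x w \<partial>area) = a w * (- ?d * Qker n z w z)"
        using Qker_reproducing_left[OF z elim, of n z] by (simp only: mult.assoc integral_mult_right_zero)
      then have "- ?d * (\<integral>x. ?G x w \<partial>area) = a w * (?d\<^sup>2 * Qker n z w z)"
        by (simp only: power2_eq_square mult_minus_left mult_minus_right minus_minus mult_ac)
      then show ?case by (simp only: of_real_power[symmetric] Qker_diagonal[OF z elim])
    qed
  qed measurable
  finally show ?thesis .
qed

text \<open>The radius is r = tanh d, written as (E - 1)/(E + 1) with E = exp(2 d).\<close>

lemma hyp_dist_small:
  assumes "0 < d"
  obtains r where "0 < r" "r < 1" "\<And>z w. cmod (phi z w) < r \<Longrightarrow> hyp_dist z w < d"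
proof
  define E where "E = exp (2 * d)"
  have E: "1 < E" using assms by (simp add: E_def)
  define r where "r = (E - 1) / (E + 1)"
  show r: "0 < r" "r < 1" using E by (auto simp: r_def)
  fix z w assume p: "cmod (phi z w) < r"
  let ?p = "cmod (phi z w)"
  have "(1 + ?p) / (1 - ?p) < E"
  proof -
    have "?p * (E + 1) < E - 1" using p E by (simp add: r_def less_divide_eq)
    then have "1 + ?p < E * (1 - ?p)" by (simp add: algebra_simps)
    then show ?thesis using p r by (simp add: divide_less_eq)
  qed
  moreover have "0 < (1 + ?p) / (1 - ?p)" using p r by (simp add: add_pos_nonneg)
  ultimately have "ln ((1 + ?p) / (1 - ?p)) < ln E" by simp
  then show "hyp_dist z w < d" by (simp add: hyp_dist_def E_def)
qed

text \<open>Approximate identity: where |phi_z| < r uniform continuity controls the oscillation of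
  b, and elsewhere the density is at most (n+1) q^n times the density for n = 0. Neither estimate
  depends on z, so the approximation is uniform.\<close>

lemma calA_approx_berezin:
  assumes b: "b \<in> calA" and e: "0 < e"
  obtains S where "bounded_op S" "\<And>z. z \<in> disc \<Longrightarrow> cmod (b z - berezin S z) < e"
proof -
  obtain M where M: "\<And>z. z \<in> disc \<Longrightarrow> cmod (b z) \<le> M" using b unfolding calA_def by blast
  have "cmod (b 0) \<le> M" by (rule M) simp
  then have M0: "0 \<le> M" using norm_ge_zero[of "b 0"] by linarith
  \<comment> \<open>Extension by zero: the operator lemmas require a symbol that is Borel and
    bounded on the whole plane.\<close>
  define a where "a = (\<lambda>z. indicator disc z *\<^sub>R b z)"
  have am[measurable]: "a \<in> borel_measurable borel"
    unfolding a_def by (intro borel_measurable_continuous_on_indicator calA_continuous_on b) auto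
  have aM: "cmod (a z) \<le> M" for z using M[of z] M0 by (simp add: a_def indicator_def)
  have ab: "a z = b z" if "z \<in> disc" for z using that by (simp add: a_def)
  have e2: "0 < e / 2" using e by simp
  then obtain d where d: "0 < d" "\<And>z w. z \<in> disc \<Longrightarrow> w \<in> disc \<Longrightarrow> hyp_dist z w < d \<Longrightarrow> cmod (b z - b w) < e / 2"
    using b unfolding calA_def by blast
  obtain r where r: "0 < r" "r < 1" "\<And>z w. cmod (phi z w) < r \<Longrightarrow> hyp_dist z w < d"
    using hyp_dist_small[OF d(1)] by blast
  \<comment> \<open>Upper bound of 1 - |phi_z|^2 off the pseudohyperbolic disc of radius r; q < 1
    makes (n+1) q^n tend to 0.\<close>
  define q where "q = 1 - r\<^sup>2"
  have q: "0 \<le> q" "q < 1" using r by (auto simp: q_def power_le_one)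
  have "(\<lambda>n. real n * q ^ n) \<longlonglongrightarrow> 0" using q by (intro powser_times_n_limit_0) auto
  moreover have "(\<lambda>n. q ^ n) \<longlonglongrightarrow> 0" using q by (intro LIMSEQ_realpow_zero) auto
  ultimately have "(\<lambda>n. 2 * M * (real n * q ^ n + q ^ n)) \<longlonglongrightarrow> 2 * M * (0 + 0)"
    by (intro tendsto_mult tendsto_add tendsto_const)
  then have "(\<lambda>n. 2 * M * (real n * q ^ n + q ^ n)) \<longlonglongrightarrow> 0" by simp
  from eventually_happens'[OF sequentially_bot order_tendstoD(2)[OF this e2]]
  obtain n where n: "2 * M * (real n * q ^ n + q ^ n) < e / 2" by blast
  let ?c = "2 * M * (real n * q ^ n + q ^ n)"
  have "cmod (b z - berezin (Qop n a) z) < e" if z: "z \<in> disc" for z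
  proof -
    note B = Bker_integral[OF z]
    have iB: "integrable area (\<lambda>w. complex_of_real (Bker n z w))" using B(1)[of n] by (rule integrable_of_real)
    have iaB: "integrable area (\<lambda>w. a w * complex_of_real (Bker n z w))"
    proof (rule Bochner_Integration.integrable_bound)
      show "integrable area (\<lambda>w. M * Bker n z w)" using B(1)[of n] by simp
      show "AE w in area. norm (a w * complex_of_real (Bker n z w)) \<le> norm (M * Bker n z w)"
        using M0 by (intro AE_I2) (auto simp: norm_mult abs_mult intro!: mult_right_mono aM)
    qed measurable
    have "b z - berezin (Qop n a) z = b z * of_real (\<integral>w. Bker n z w \<partial>area) - (\<integral>w. a w * of_real (Bker n z w) \<partial>area)"
      by (simp add: berezin_Qop[OF am aM z] B)
    also have "\<dots> = (\<integral>w. b z * of_real (Bker n z w) - a w * of_real (Bker n z w) \<partial>area)"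
      using iB iaB by simp
    finally have "cmod (b z - berezin (Qop n a) z) = cmod (\<integral>w. b z * of_real (Bker n z w) - a w * of_real (Bker n z w) \<partial>area)"
      by simp
    also have "\<dots> \<le> (\<integral>w. norm (b z * of_real (Bker n z w) - a w * of_real (Bker n z w)) \<partial>area)"
      by (rule integral_norm_bound)
    \<comment> \<open>One majorant serves both regions: the first term covers points near z, the
      second the rest. Both densities have mass 1, so it integrates to e/2 + ?c.\<close>
    also have "\<dots> \<le> (\<integral>w. e / 2 * Bker n z w + ?c * Bker 0 z w \<partial>area)"
    proof (rule integral_mono_AE)
      show "integrable area (\<lambda>w. norm (b z * of_real (Bker n z w) - a w * of_real (Bker n z w)))"
        using iB iaB by (intro integrable_norm Bochner_Integration.integrable_diff integrable_mult_right)
      show "integrable area (\<lambda>w. e / 2 * Bker n z w + ?c * Bker 0 z w)" using B(1)[of n] B(1)[of 0] by simp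
      show "AE w in area. norm (b z * of_real (Bker n z w) - a w * of_real (Bker n z w)) \<le> e / 2 * Bker n z w + ?c * Bker 0 z w"
        using AE_area
      proof eventually_elim
        case w: (elim w)
        have nn: "0 \<le> Bker k z w" for k by (rule Bker_nonneg[OF z w])
        have c0: "0 \<le> ?c" using M0 q by simp
        have "b z * of_real (Bker n z w) - a w * of_real (Bker n z w) = (b z - b w) * of_real (Bker n z w)"
          by (simp add: ab[OF w] left_diff_distrib)
        then have eq: "norm (b z * of_real (Bker n z w) - a w * of_real (Bker n z w)) = cmod (b z - b w) * Bker n z w"
          using nn by (simp add: norm_mult)
        show ?case
        proof (cases "cmod (phi z w) < r")
          case True
          then have "cmod (b z - b w) \<le> e / 2" using d(2)[OF z w r(3)] by simp
          then have "cmod (b z - b w) * Bker n z w \<le> e / 2 * Bker n z w" using nn by (rule mult_right_mono)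
          then show ?thesis unfolding eq using mult_nonneg_nonneg[OF c0 nn[of 0]] by linarith
        next
          case False
          then have "r\<^sup>2 \<le> (cmod (phi z w))\<^sup>2" using r by (intro power_mono) auto
          moreover have "0 \<le> 1 - (cmod (phi z w))\<^sup>2" using norm_phi_less_1[OF z w] by (simp add: power_le_one)
          ultimately have "(1 - (cmod (phi z w))\<^sup>2) ^ n \<le> q ^ n" unfolding q_def by (intro power_mono) auto
          then have "real (n + 1) * (1 - (cmod (phi z w))\<^sup>2) ^ n * Bker 0 z w \<le> real (n + 1) * q ^ n * Bker 0 z w"
            by (intro mult_right_mono mult_left_mono nn) auto
          then have le: "Bker n z w \<le> real (n + 1) * q ^ n * Bker 0 z w" by (simp add: Bker_def)
          have "cmod (b z - b w) \<le> 2 * M"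
            using norm_triangle_ineq4[of "b z" "b w"] M[OF z] M[OF w] by linarith
          then have "cmod (b z - b w) * Bker n z w \<le> 2 * M * (real (n + 1) * q ^ n * Bker 0 z w)"
            using le M0 nn by (intro mult_mono) auto
          also have "\<dots> = ?c * Bker 0 z w" by (simp add: algebra_simps)
          finally show ?thesis unfolding eq using mult_nonneg_nonneg[OF less_imp_le[OF e2] nn[of n]] by linarith
        qed
      qed
    qed
    also have "\<dots> = e / 2 + ?c" using B[of n] B[of 0] by simp
    also have "\<dots> < e" using n by simp
    finally show ?thesis .
  qed
  with Qop_bounded_op[OF am aM] show thesis by (rule that)
qed

text \<open>\<open>Linf_closure\<close> sees functions only up to null sets of the disc, so equality
  with the algebra means having a representative in \<open>calA\<close>. By continuity this
  representative is unique on the disc.\<close>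

theorem theorem3p2:
  shows "Linf_closure berezin_range =
    {a. \<exists>b\<in>calA. AE z in lebesgue. z \<in> disc \<longrightarrow> a z = b z}"
proof (intro equalityI subsetI CollectI)
  fix a assume "a \<in> Linf_closure berezin_range"
  then show "\<exists>b\<in>calA. AE z in lebesgue. z \<in> disc \<longrightarrow> a z = b z"
    by (rule Linf_closure_subset) (auto simp: berezin_range_def berezin_in_calA)
next
  fix a assume "a \<in> {a. \<exists>b\<in>calA. AE z in lebesgue. z \<in> disc \<longrightarrow> a z = b z}"
  then obtain b where b: "b \<in> calA" "AE z in lebesgue. z \<in> disc \<longrightarrow> a z = b z" by blast
  show "a \<in> Linf_closure berezin_range"
    unfolding Linf_closure_def
  proof (intro CollectI allI impI)
    fix e :: real assume "0 < e"
    then obtain S where S: "bounded_op S" "\<And>z. z \<in> disc \<Longrightarrow> cmod (b z - berezin S z) < e"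
      using calA_approx_berezin[OF b(1)] by blast
    show "\<exists>s\<in>berezin_range. AE z in lebesgue. z \<in> disc \<longrightarrow> cmod (a z - s z) < e"
    proof
      show "berezin S \<in> berezin_range" using S(1) by (auto simp: berezin_range_def)
      show "AE z in lebesgue. z \<in> disc \<longrightarrow> cmod (a z - berezin S z) < e"
        using b(2) by eventually_elim (use S(2) in auto)
    qed
  qed
qed

end
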